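(* Let $p$ be a prime. (1) $\rho_p(2,2)=\frac{7}{12}$ if $p=2$, and $\rho_p(2,2)=1-\frac{3}{2}p^{-1}\left(\frac{1-p^{-1}}{1-p^{-2}}\right)^2$ if $p\neq 2$. (2) $\rho_p(3,2)=\frac{1231}{1296}$ if $p=2$, and $\rho_p(3,2)=1-\frac{3}{2}p^{-2}\left(\frac{1-p^{-1}}{1-p^{-2}}\right)^4$ if $p\ne 2$. (3) If $n\ge 4$, then $\rho_p(n,2)=1$.
   Context: For $n,k\in\mathbb{Z}_{\ge 2}$ and $\mathbf a=(a_0,\dots,a_n)$, let $X^k_{\mathbf a}\subset\mathbb{P}^n$ denote the diagonal hypersurface $\sum_{i=0}^n a_ix_i^k=0$. For a prime $p$ let $\mu_p$ be the Haar measure on $\mathbb{Z}_p$ normalized by $\mu_p(\mathbb{Z}_p)=1$, and also the product measure on $\mathbb{Z}_p^{n+1}$. Define $\rho_p(n,k)=\mu_p(\{\mathbf a\in\mathbb{Z}_p^{n+1}: X^k_{\mathbf a}(\mathbb{Q}_p)\neq\emptyset\})$. *)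

theory Defs
  imports "HOL-Probability.Probability"
begin

text \<open>The p-adic integers Z_p are modelled by their p-adic digit expansions:
an element is a digit sequence d :: nat => nat with d j < p, representing
sum_j d j * p^j.  Its residue modulo p^k is the truncated sum.\<close>

definition zp_digits :: "nat \<Rightarrow> (nat \<Rightarrow> nat) set" where
  "zp_digits p = {d. \<forall>j. d j < p}"

definition zp_res :: "nat \<Rightarrow> (nat \<Rightarrow> nat) \<Rightarrow> nat \<Rightarrow> int" where
  "zp_res p d k = (\<Sum>j<k. int (d j) * int p ^ j)"

text \<open>Normalized Haar measure on Z_p: product of uniform measures on the digits.\<close>
definition zp_measure :: "nat \<Rightarrow> (nat \<Rightarrow> nat) measure" where
  "zp_measure p = (\<Pi>\<^sub>M j\<in>(UNIV::nat set). uniform_count_measure {..<p})"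

definition zp_vec_measure :: "nat \<Rightarrow> nat \<Rightarrow> (nat \<Rightarrow> nat \<Rightarrow> nat) measure" where
  "zp_vec_measure p n = (\<Pi>\<^sub>M i\<in>{..n}. zp_measure p)"

text \<open>The diagonal form sum a_i x_i^k vanishes in Z_p = lim Z/p^m.\<close>
definition diag_form_zero :: "nat \<Rightarrow> nat \<Rightarrow> nat \<Rightarrow> (nat \<Rightarrow> nat \<Rightarrow> nat) \<Rightarrow> (nat \<Rightarrow> nat \<Rightarrow> nat) \<Rightarrow> bool" where
  "diag_form_zero p n k a x =
     (\<forall>m. int p ^ m dvd (\<Sum>i\<le>n. zp_res p (a i) m * zp_res p (x i) m ^ k))"

text \<open>X^k_a(Q_p) nonempty: a nonzero vector of p-adic numbers on the hypersurface.
By homogeneity (clear denominators) it suffices to take it in Z_p^(n+1).\<close>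
definition has_Qp_point :: "nat \<Rightarrow> nat \<Rightarrow> nat \<Rightarrow> (nat \<Rightarrow> nat \<Rightarrow> nat) \<Rightarrow> bool" where
  "has_Qp_point p n k a =
     (\<exists>x. (\<forall>i\<le>n. x i \<in> zp_digits p) \<and> (\<exists>i\<le>n. \<exists>j. x i j \<noteq> 0) \<and> diag_form_zero p n k a x)"

definition rho :: "nat \<Rightarrow> nat \<Rightarrow> nat \<Rightarrow> real" where
  "rho p n k = measure (zp_vec_measure p n)
      {a \<in> space (zp_vec_measure p n). has_Qp_point p n k a}"

end

theory Submission
  imports Defs "HOL-Number_Theory.Cong"
begin

text \<open>
  A nonzero coefficient contributes only through its square class, and by Hensel's lemma that class
  is read off from the parity of the valuation and the leading digits (one digit for odd \<open>p\<close>, three for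
  \<open>p = 2\<close>). Summing a geometric series over the valuation gives the measure of each class, and the
  coefficients are independent, so the insoluble coefficient vectors have a measure that is a finite
  sum over anisotropic tuples of square classes; a form with a zero coefficient is always isotropic.
  For odd \<open>p\<close> a form is anisotropic iff both residue forms are, which bounds each of them by two
  variables. For \<open>p = 2\<close> the anisotropic tuples are enumerated by a search modulo 8.
\<close>

section \<open>Coherent sequences as p-adic integers\<close>

text \<open>Digit sequences carry no convenient arithmetic, so a p-adic integer is handled as an
  integer sequence whose m-th term matters only modulo p^m, and \<open>zp_null\<close> is being
  zero. There is no field to divide in: a substitution by nonzero p-adic factors is undone by
  multiplying through. The complement is the easier event because anisotropy passes to suffixes:
  this prunes the enumeration and leaves a finite union of measurable boxes. The weight of a class
  depends only on the parity e of its valuation: p/(2(p+1)) and 1/(2(p+1)) for odd p, 2/12 and 1/12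
  for p = 2. For odd p, a ternary anisotropic form splits into residue forms as 2 + 1 variables and
  a quaternary one as 2 + 2, while five variables force a residue form in three. At p = 2 the
  relevant modulus is 8, where terms with a factor 2 do not drop out, so the two parities interact
  and a finite search replaces the splitting.\<close>

lemma dvd_diff_imp_dvd_iff:
  fixes d :: int
  assumes "d dvd x - y"
  shows "d dvd x \<longleftrightarrow> d dvd y"
  using assms dvd_add[of d "x - y" y] dvd_diff[of d x "x - y"] by auto

text \<open>The m-th term is any representative modulo p^m, not a reduced one, so that products can
  be formed termwise.\<close>

definition zp_coherent :: "nat \<Rightarrow> (nat \<Rightarrow> int) \<Rightarrow> bool" where
  "zp_coherent p f \<longleftrightarrow> (\<forall>m. int p ^ m dvd f (Suc m) - f m)"

definition zp_null :: "nat \<Rightarrow> (nat \<Rightarrow> int) \<Rightarrow> bool" where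
  "zp_null p f \<longleftrightarrow> (\<forall>m. int p ^ m dvd f m)"

lemma zp_coherent_le:
  assumes "zp_coherent p f" "m \<le> k"
  shows "int p ^ m dvd f k - f m"
  using assms(2)
proof (induction k rule: dec_induct)
  case base
  show ?case by simp
next
  case (step k)
  have "int p ^ m dvd f (Suc k) - f k"
    using assms(1) step.hyps le_imp_power_dvd[of m k "int p"] dvd_trans
    unfolding zp_coherent_def by blast
  then have "int p ^ m dvd (f (Suc k) - f k) + (f k - f m)"
    using step.IH by (rule dvd_add)
  then show ?case by simp
qed

lemma zp_coherent_const: "zp_coherent p (\<lambda>_. c)"
  by (simp add: zp_coherent_def)

lemma zp_coherent_mult:
  assumes "zp_coherent p f" "zp_coherent p g"
  shows "zp_coherent p (\<lambda>m. f m * g m)"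
  unfolding zp_coherent_def
proof
  fix m
  have "f (Suc m) * g (Suc m) - f m * g m = (f (Suc m) - f m) * g (Suc m) + f m * (g (Suc m) - g m)"
    by (simp add: algebra_simps)
  then show "int p ^ m dvd f (Suc m) * g (Suc m) - f m * g m"
    using assms unfolding zp_coherent_def by (metis dvd_add dvd_mult dvd_mult2)
qed

lemma zp_coherent_prod:
  "(\<And>i. i \<in> I \<Longrightarrow> zp_coherent p (f i)) \<Longrightarrow> zp_coherent p (\<lambda>m. \<Prod>i\<in>I. f i m)"
proof (induction I rule: infinite_finite_induct)
  case (insert i I)
  then show ?case using zp_coherent_mult[of p "f i" "\<lambda>m. \<Prod>i\<in>I. f i m"] by simp
qed (simp_all add: zp_coherent_const)

lemma not_zp_nullD:
  assumes "zp_coherent p f" "\<not> int p ^ m dvd f m" "m \<le> k"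
  shows "\<not> int p ^ m dvd f k"
proof
  assume "int p ^ m dvd f k"
  from dvd_diff[OF this zp_coherent_le[OF assms(1,3)]] show False using assms(2) by simp
qed

lemma prime_power_not_dvd_mult:
  fixes q :: int
  assumes "prime q" "\<not> q ^ a dvd x" "\<not> q ^ b dvd y"
  shows "\<not> q ^ (a + b) dvd x * y"
proof
  assume *: "q ^ (a + b) dvd x * y"
  have "x \<noteq> 0" "y \<noteq> 0" using assms by auto
  then have "multiplicity q (x * y) = multiplicity q x + multiplicity q y"
    using assms(1) by (intro prime_elem_multiplicity_mult_distrib) auto
  moreover have "a + b \<le> multiplicity q (x * y)"
    using * \<open>x \<noteq> 0\<close> \<open>y \<noteq> 0\<close> assms(1)
    by (intro multiplicity_geI) auto
  moreover have "multiplicity q x < a" "multiplicity q y < b"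
    using assms multiplicity_dvd' by (meson not_le)+
  ultimately show False by simp
qed

text \<open>The p-adic integers have no zero divisors: valuations add, so failures of divisibility
  at levels \<open>a\<close> and \<open>b\<close> combine to one at level
  \<open>a + b\<close>.\<close>

lemma zp_not_null_mult:
  assumes "prime p" "zp_coherent p f" "zp_coherent p g" "\<not> zp_null p f" "\<not> zp_null p g"
  shows "\<not> zp_null p (\<lambda>m. f m * g m)"
proof -
  obtain a b where ab: "\<not> int p ^ a dvd f a" "\<not> int p ^ b dvd g b"
    using assms(4,5) by (auto simp: zp_null_def)
  have "\<not> int p ^ (a + b) dvd f (a + b) * g (a + b)"
    using not_zp_nullD[OF assms(2) ab(1)] not_zp_nullD[OF assms(3) ab(2)] assms(1)
    by (intro prime_power_not_dvd_mult) auto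
  then show ?thesis by (auto simp: zp_null_def)
qed

lemma zp_not_null_prod:
  assumes "prime p" "finite I"
    and "\<And>i. i \<in> I \<Longrightarrow> zp_coherent p (f i)" "\<And>i. i \<in> I \<Longrightarrow> \<not> zp_null p (f i)"
  shows "\<not> zp_null p (\<lambda>m. \<Prod>i\<in>I. f i m)"
  using assms(2-)
proof (induction I rule: finite_induct)
  case empty
  have "\<not> int p ^ 1 dvd 1" using assms(1) by (auto simp: zdvd1_eq dest: prime_gt_1_nat)
  then show ?case by (auto simp: zp_null_def intro: exI[of _ 1])
next
  case (insert i I)
  then show ?case
    using zp_not_null_mult[OF assms(1), of "f i" "\<lambda>m. \<Prod>i\<in>I. f i m"]
    by (simp add: zp_coherent_prod)
qed

lemma zp_not_nullI: "\<not> int p dvd f 1 \<Longrightarrow> \<not> zp_null p f"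
  by (auto simp: zp_null_def intro: exI[of _ 1])

section \<open>Digit expansions and coherent sequences\<close>

lemma zp_res_Suc: "zp_res p d (Suc m) = zp_res p d m + int (d m) * int p ^ m"
  by (simp add: zp_res_def)

lemma zp_coherent_zp_res: "zp_coherent p (zp_res p d)"
  by (simp add: zp_coherent_def zp_res_Suc)

lemma zp_res_nonneg: "0 \<le> zp_res p d m"
  by (simp add: zp_res_def sum_nonneg)

lemma zp_res_less:
  assumes "d \<in> zp_digits p"
  shows "zp_res p d m < int p ^ m"
proof (induction m)
  case (Suc m)
  have "int (d m) \<le> int p - 1" using assms by (simp add: zp_digits_def)
  then have "int (d m) * int p ^ m \<le> (int p - 1) * int p ^ m"
    by (rule mult_right_mono) simp
  then show ?case using Suc by (simp add: zp_res_Suc algebra_simps)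
qed (simp add: zp_res_def)

lemma zp_null_zp_res_iff:
  assumes "d \<in> zp_digits p"
  shows "zp_null p (zp_res p d) \<longleftrightarrow> (\<forall>j. d j = 0)"
proof
  assume null: "zp_null p (zp_res p d)"
  have p: "0 < p" using assms by (auto simp: zp_digits_def intro: gr0I)
  have "zp_res p d m = 0" for m
    using null zp_res_less[OF assms, of m] zp_res_nonneg[of p d m] zdvd_not_zless
    unfolding zp_null_def by (metis order_le_less)
  then have "int (d j) * int p ^ j = 0" for j
    using zp_res_Suc[of p d j] by simp
  then show "\<forall>j. d j = 0" using p by simp
next
  assume "\<forall>j. d j = 0"
  then show "zp_null p (zp_res p d)" by (simp add: zp_null_def zp_res_def)
qed

text \<open>Digit j is the p^j-place of the residue modulo p^(j+1); coherence guarantees that later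
  terms do not change it.\<close>

lemma zp_digits_of_coherent:
  assumes "0 < p" "zp_coherent p f"
  obtains d where "d \<in> zp_digits p" "\<And>m. zp_res p d m = f m mod int p ^ m"
proof -
  define d where "d j = nat ((f (Suc j) mod int p ^ Suc j) div int p ^ j)" for j
  have nn: "0 \<le> (f (Suc j) mod int p ^ Suc j) div int p ^ j" for j
    using assms(1) by (simp add: pos_imp_zdiv_nonneg_iff del: power_Suc)
  have "(f (Suc j) mod int p ^ Suc j) div int p ^ j < int p" for j
  proof -
    have "f (Suc j) mod int p ^ Suc j < int p ^ Suc j"
      using assms(1) by (intro pos_mod_bound) simp
    moreover have "(f (Suc j) mod int p ^ Suc j) div int p ^ j * int p ^ j \<le> f (Suc j) mod int p ^ Suc j"
      using assms(1) by (simp add: minus_mod_eq_div_mult[symmetric] del: power_Suc)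
    ultimately have "(f (Suc j) mod int p ^ Suc j) div int p ^ j * int p ^ j < int p * int p ^ j" by simp
    then show ?thesis using assms(1) by (simp del: power_Suc)
  qed
  then have d: "d \<in> zp_digits p"
    using nn by (auto simp: zp_digits_def d_def nat_less_iff)
  have "zp_res p d m = f m mod int p ^ m" for m
  proof (induction m)
    case (Suc m)
    have "f (Suc m) mod int p ^ Suc m mod int p ^ m = f (Suc m) mod int p ^ m"
      by (intro mod_mod_cancel) simp
    also have "\<dots> = f m mod int p ^ m"
      using assms(2) by (simp add: zp_coherent_def mod_eq_dvd_iff)
    finally have "f m mod int p ^ m = f (Suc m) mod int p ^ Suc m mod int p ^ m" by simp
    then show ?case
      using nn[of m] Suc by (simp add: zp_res_Suc d_def mod_div_mult_eq del: power_Suc)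
  qed (simp add: zp_res_def)
  with d show thesis by (rule that)
qed

text \<open>Moves the unknowns to coherent sequences, where they can be multiplied and corrected;
  the coefficients stay digit sequences because the measure lives there.\<close>

lemma has_Qp_point_iff_coherent:
  assumes "prime p"
  shows "has_Qp_point p n k a \<longleftrightarrow>
    (\<exists>x. (\<forall>i\<le>n. zp_coherent p (x i)) \<and> (\<exists>i\<le>n. \<not> zp_null p (x i)) \<and>
         zp_null p (\<lambda>m. \<Sum>i\<le>n. zp_res p (a i) m * x i m ^ k))"
    (is "_ \<longleftrightarrow> (\<exists>x. ?P x)")
proof
  assume "has_Qp_point p n k a"
  then obtain x where x: "\<forall>i\<le>n. x i \<in> zp_digits p" "\<exists>i\<le>n. \<exists>j. x i j \<noteq> 0" "diag_form_zero p n k a x"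
    unfolding has_Qp_point_def by metis
  show "\<exists>x. ?P x"
  proof (rule exI[where x = "\<lambda>i. zp_res p (x i)"], intro conjI allI impI)
    show "\<exists>i\<le>n. \<not> zp_null p (zp_res p (x i))"
      using x(1,2) by (auto simp: zp_null_zp_res_iff)
    show "zp_null p (\<lambda>m. \<Sum>i\<le>n. zp_res p (a i) m * zp_res p (x i) m ^ k)"
      using x(3) by (simp add: diag_form_zero_def zp_null_def)
  qed (rule zp_coherent_zp_res)
next
  assume "\<exists>x. ?P x"
  then obtain x where x: "?P x" by (rule exE)
  have p: "0 < p" using assms prime_gt_0_nat by blast
  have "\<exists>d. d \<in> zp_digits p \<and> (\<forall>m. zp_res p d m = x i m mod int p ^ m)" if "i \<le> n" for i
  proof -
    have "zp_coherent p (x i)" using x that by simp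
    then show ?thesis by (metis zp_digits_of_coherent[OF p])
  qed
  then obtain d where d: "\<And>i. i \<le> n \<Longrightarrow> d i \<in> zp_digits p"
    "\<And>i m. i \<le> n \<Longrightarrow> zp_res p (d i) m = x i m mod int p ^ m"
    by metis
  have "\<exists>j. d i j \<noteq> 0" if "i \<le> n" "\<not> zp_null p (x i)" for i
  proof -
    have "\<not> zp_null p (zp_res p (d i))"
      using that by (auto simp: zp_null_def d(2) dvd_mod_iff)
    then show ?thesis using d(1) that zp_null_zp_res_iff by simp
  qed
  moreover have "diag_form_zero p n k a d"
    unfolding diag_form_zero_def
  proof
    fix m
    have "[(\<Sum>i\<le>n. zp_res p (a i) m * zp_res p (d i) m ^ k) =
          (\<Sum>i\<le>n. zp_res p (a i) m * x i m ^ k)] (mod int p ^ m)"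
      by (intro cong_sum cong_mult cong_pow cong_refl) (auto simp: d(2) cong_def)
    then show "int p ^ m dvd (\<Sum>i\<le>n. zp_res p (a i) m * zp_res p (d i) m ^ k)"
      using x by (simp add: zp_null_def cong_dvd_iff)
  qed
  ultimately show "has_Qp_point p n k a"
    unfolding has_Qp_point_def using d(1) x by (intro exI[where x = d]) auto
qed

section \<open>Square classes and Hensel's lemma\<close>

text \<open>A \<open>p\<close>-adic unit congruent to a unit square modulo \<open>p ^ hensel_exp p\<close> is itself a square.\<close>

definition hensel_exp :: "nat \<Rightarrow> nat" where
  "hensel_exp p = (if p = 2 then 3 else 1)"

text \<open>A Newton step towards \<open>r * y\<^sup>2 = N\<close>. The derivative 2ry has the
  valuation e of 2, so a change of y by p^(m+e+1) t acts linearly at level m+2e+1, and the quadratic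
  term is already divisible by p^(2m+2e+2).\<close>

lemma hensel_sqrt_step:
  fixes r y :: int
  assumes "prime p" "zp_coherent p N" "\<not> int p dvd r" "\<not> int p dvd y"
    and "int p ^ (m + hensel_exp p) dvd r * y\<^sup>2 - N (m + hensel_exp p)"
  shows "\<exists>z. int p ^ (Suc m + hensel_exp p) dvd r * z\<^sup>2 - N (Suc m + hensel_exp p) \<and>
             \<not> int p dvd z \<and> int p ^ Suc m dvd z - y"
proof -
  \<comment> \<open>\<open>e\<close> is the p-adic valuation of 2 and \<open>q\<close> the unit part
    of 2, whence \<open>hensel_exp p = 2 * e + 1\<close>.\<close>
  define e :: nat where "e = (if p = 2 then 1 else 0)"
  define q :: int where "q = (if p = 2 then 1 else 2)"
  have L: "hensel_exp p = 2 * e + 1" by (simp add: hensel_exp_def e_def)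
  have q2: "int p ^ e * q = 2" by (simp add: e_def q_def)
  have pi: "prime (int p)" using assms(1) by simp
  have "\<not> int p dvd q"
  proof (cases "p = 2")
    case False
    then have "\<not> p dvd 2" using assms(1) by (metis primes_dvd_imp_eq two_is_prime_nat)
    then have "\<not> int p dvd int 2" by (simp only: of_nat_dvd_iff not_False_eq_True)
    then show ?thesis using False by (simp add: q_def)
  qed (simp add: q_def)
  then have "\<not> int p dvd q * r * y"
    using assms(3,4) pi by (simp add: prime_dvd_mult_iff)
  then have "coprime (q * r * y) (int p)"
    using pi by (metis coprime_commute prime_imp_coprime)
  then obtain w where w: "[q * r * y * w = 1] (mod int p)"
    using cong_solve_coprime_int by blast
  have "int p ^ (m + hensel_exp p) dvd N (Suc m + hensel_exp p) - N (m + hensel_exp p)"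
    using assms(2) by (simp add: zp_coherent_def)
  from dvd_diff[OF assms(5) this]
  have "int p ^ (m + hensel_exp p) dvd r * y\<^sup>2 - N (Suc m + hensel_exp p)"
    by simp
  then obtain A where A: "r * y\<^sup>2 - N (Suc m + hensel_exp p) = int p ^ (m + hensel_exp p) * A"
    by (auto elim: dvdE)
  \<comment> \<open>\<open>w\<close> inverts \<open>q * r * y\<close> modulo p, so this correction
    cancels the error \<open>A\<close> modulo p.\<close>
  define t where "t = - A * w"
  have "int p dvd A * (1 - q * r * y * w)"
    using w by (auto simp: cong_iff_dvd_diff dvd_diff_commute)
  then have "int p dvd A + q * r * y * t" by (simp add: t_def algebra_simps)
  then obtain B where B: "A + q * r * y * t = int p * B" by (auto elim: dvdE)
  define z where "z = y + int p ^ (m + e + 1) * t"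
  have p1: "int p ^ (m + hensel_exp p) = int p ^ (m + e + 1) * int p ^ e"
    by (simp only: L power_add[symmetric]) (simp add: mult_2 add.assoc)
  have p2: "int p ^ (m + e + 1) * int p ^ (m + e + 1) = int p ^ (Suc m + hensel_exp p) * int p ^ m"
    by (simp only: L power_add[symmetric]) (rule arg_cong[of _ _ "(^) (int p)"], simp)
  have p3: "int p ^ (Suc m + hensel_exp p) = int p ^ (m + hensel_exp p) * int p" by simp
  have "r * z\<^sup>2 - N (Suc m + hensel_exp p)
      = (r * y\<^sup>2 - N (Suc m + hensel_exp p)) + int p ^ (m + e + 1) * (2 * r * y * t)
        + r * t\<^sup>2 * (int p ^ (m + e + 1) * int p ^ (m + e + 1))"
    unfolding z_def by (simp only: power2_eq_square ring_distribs) (simp add: ac_simps)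
  also have "\<dots> = int p ^ (m + hensel_exp p) * (A + q * r * y * t)
        + r * t\<^sup>2 * (int p ^ (Suc m + hensel_exp p) * int p ^ m)"
    unfolding A p1 p2 q2[symmetric] by (simp only: ring_distribs ac_simps)
  also have "\<dots> = int p ^ (Suc m + hensel_exp p) * (B + r * t\<^sup>2 * int p ^ m)"
    unfolding B p3 by (simp only: ring_distribs ac_simps)
  finally have 1: "int p ^ (Suc m + hensel_exp p) dvd r * z\<^sup>2 - N (Suc m + hensel_exp p)"
    by (metis dvd_triv_left)
  have 2: "int p ^ Suc m dvd z - y"
    by (simp add: z_def power_add)
  then have "int p dvd z - y" by (metis dvd_mult_left power_Suc)
  then have "\<not> int p dvd z"
    using assms(4) dvd_diff[of "int p" z "z - y"] by auto
  with 1 2 show ?thesis by blast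
qed

lemma hensel_sqrt:
  fixes r x :: int
  assumes "prime p" "zp_coherent p N" "\<not> int p dvd r" "\<not> int p dvd x"
    and "int p ^ hensel_exp p dvd r * x\<^sup>2 - N (hensel_exp p)"
  obtains y where "zp_coherent p y" "\<And>m. int p ^ m dvd r * (y m)\<^sup>2 - N m" "\<And>m. \<not> int p dvd y m"
proof -
  \<comment> \<open>The accuracy runs \<open>hensel_exp p\<close> levels ahead of the index. Being a
    unit belongs to the invariant because the next step inverts \<open>y\<close> modulo p.\<close>
  have "\<exists>y. \<forall>m. (int p ^ (m + hensel_exp p) dvd r * (y m)\<^sup>2 - N (m + hensel_exp p) \<and> \<not> int p dvd y m)
      \<and> int p ^ Suc m dvd y (Suc m) - y m"
  proof (rule dependent_nat_choice)
    show "\<exists>x. int p ^ (0 + hensel_exp p) dvd r * x\<^sup>2 - N (0 + hensel_exp p) \<and> \<not> int p dvd x"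
      using assms by auto
  qed (use hensel_sqrt_step[OF assms(1-3)] in blast)
  then obtain y where y: "\<And>m. int p ^ (m + hensel_exp p) dvd r * (y m)\<^sup>2 - N (m + hensel_exp p)"
    "\<And>m. \<not> int p dvd y m" "\<And>m. int p ^ Suc m dvd y (Suc m) - y m"
    by blast
  have "zp_coherent p y"
    unfolding zp_coherent_def using y(3) by (metis dvd_mult_right power_Suc)
  moreover have "int p ^ m dvd r * (y m)\<^sup>2 - N m" for m
  proof -
    have "int p ^ m dvd r * (y m)\<^sup>2 - N (m + hensel_exp p)"
      using y(1)[of m] by (metis dvd_mult_left power_add)
    moreover have "int p ^ m dvd N (m + hensel_exp p) - N m"
      using assms(2) by (rule zp_coherent_le) simp
    ultimately show ?thesis using dvd_add by fastforce
  qed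
  ultimately show thesis using y(2) that by blast
qed

text \<open>A pair \<open>(e, t)\<close> encodes the coefficient \<open>p ^ e * t\<close>. By Hensel's lemma, isotropy over the
  \<open>p\<close>-adic numbers amounts to the existence of a solution modulo a fixed power of \<open>p\<close>, the power
  depending on the coordinate that is a unit.\<close>

definition diag_quad_iso :: "nat \<Rightarrow> (nat \<times> int) list \<Rightarrow> bool" where
  "diag_quad_iso p l \<longleftrightarrow> (\<exists>x. \<exists>i<length l. \<not> int p dvd x i \<and>
     int p ^ (hensel_exp p + fst (l ! i)) dvd
       (\<Sum>j<length l. int p ^ fst (l ! j) * snd (l ! j) * (x j)\<^sup>2))"

text \<open>The smallest valuation h among the coordinates is divided out. The form is quadratic, so
  this costs 2h levels of precision, which are available because the form vanishes at every
  level.\<close>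

lemma zp_primitive_solution:
  fixes x :: "nat \<Rightarrow> nat \<Rightarrow> int" and c :: "nat \<Rightarrow> int"
  assumes "prime p" "\<And>i. i \<in> I \<Longrightarrow> zp_coherent p (x i)" "i0 \<in> I" "\<not> zp_null p (x i0)"
    and null: "zp_null p (\<lambda>m. \<Sum>i\<in>I. c i * (x i m)\<^sup>2)"
  obtains y i where "i \<in> I" "\<not> int p dvd y i" "int p ^ M dvd (\<Sum>i\<in>I. c i * (y i)\<^sup>2)"
proof -
  define Q where "Q h \<longleftrightarrow> (\<exists>i\<in>I. \<not> int p ^ Suc h dvd x i (Suc h))" for h
  obtain m where m: "\<not> int p ^ m dvd x i0 m" using assms(4) by (auto simp: zp_null_def)
  then have "m \<noteq> 0" by (intro notI) simp
  then obtain h' where "m = Suc h'" by (cases m) auto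
  then have "Q h'" using m assms(3) unfolding Q_def by blast
  define h where "h = (LEAST h. Q h)"
  have "Q h" using \<open>Q h'\<close> unfolding h_def by (rule LeastI)
  then obtain i where i: "i \<in> I" "\<not> int p ^ Suc h dvd x i (Suc h)" unfolding Q_def by blast
  have dv: "int p ^ h dvd x j h" if "j \<in> I" for j
  proof (cases h)
    case (Suc k)
    then have "\<not> Q k" unfolding h_def using not_less_Least by (metis lessI)
    then show ?thesis using Suc that unfolding Q_def by blast
  qed simp
  \<comment> \<open>2h levels are lost to the division and M must remain; the extra 1 ensures K > h,
    so that level K still shows that coordinate i has valuation h.\<close>
  define K where "K = 2 * h + M + 1"
  have "int p ^ h dvd x j K" if "j \<in> I" for j
  proof -
    have "int p ^ h dvd x j K - x j h"
      using assms(2)[OF that] by (rule zp_coherent_le) (simp add: K_def)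
    then show ?thesis using dv[OF that] by (metis dvd_add diff_add_cancel)
  qed
  then obtain y where y: "\<And>j. j \<in> I \<Longrightarrow> x j K = int p ^ h * y j"
    unfolding dvd_def by metis
  have "\<not> int p ^ Suc h dvd x i K"
    using assms(2)[OF i(1)] i(2) by (rule not_zp_nullD) (simp add: K_def)
  then have "\<not> int p dvd y i" using y[OF i(1)] by (auto simp: mult.commute)
  moreover have "int p ^ M dvd (\<Sum>i\<in>I. c i * (y i)\<^sup>2)"
  proof -
    have "int p ^ K dvd (\<Sum>i\<in>I. c i * (x i K)\<^sup>2)"
      using null by (simp add: zp_null_def)
    also have "(\<Sum>i\<in>I. c i * (x i K)\<^sup>2) = int p ^ (2 * h) * (\<Sum>i\<in>I. c i * (y i)\<^sup>2)"
      unfolding sum_distrib_left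
      by (intro sum.cong refl) (simp add: y power_mult_distrib power_mult[symmetric] mult.commute ac_simps)
    finally have "int p ^ (2 * h) * int p ^ (M + 1) dvd int p ^ (2 * h) * (\<Sum>i\<in>I. c i * (y i)\<^sup>2)"
      by (simp add: K_def power_add[symmetric] ac_simps)
    then have "int p ^ (M + 1) dvd (\<Sum>i\<in>I. c i * (y i)\<^sup>2)"
      using assms(1) prime_gt_0_nat[of p] by (subst (asm) dvd_mult_cancel_left) auto
    then show ?thesis by (metis dvd_mult_left power_add)
  qed
  ultimately show thesis using i(1) that by blast
qed

lemma zp_null_cong:
  assumes "\<And>m. int p ^ m dvd f m - g m"
  shows "zp_null p f \<longleftrightarrow> zp_null p g"
proof -
  have "int p ^ m dvd f m \<longleftrightarrow> int p ^ m dvd g m" for m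
    using assms[of m] by (rule dvd_diff_imp_dvd_iff)
  then show ?thesis by (simp add: zp_null_def)
qed

text \<open>Nonzero square factors of the coefficients are absorbed into the variables. A p-adic
  zero yields primitive solutions to any precision; conversely, all coordinates but a unit one are
  frozen at integer values and Hensel's lemma corrects that one.\<close>

lemma has_Qp_point_iff_diag_quad_iso:
  fixes l :: "(nat \<times> int) list"
  assumes p: "prime p" and l: "length l = Suc n"
    and unit: "\<And>i. i \<le> n \<Longrightarrow> \<not> int p dvd snd (l ! i)"
    and s: "\<And>i. i \<le> n \<Longrightarrow> zp_coherent p (s i)" "\<And>i. i \<le> n \<Longrightarrow> \<not> zp_null p (s i)"
    and a: "\<And>i m. i \<le> n \<Longrightarrow>
      int p ^ m dvd zp_res p (a i) m - int p ^ fst (l ! i) * snd (l ! i) * (s i m)\<^sup>2"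
  shows "has_Qp_point p n 2 a \<longleftrightarrow> diag_quad_iso p l"
proof -
  define c where "c i = int p ^ fst (l ! i) * snd (l ! i)" for i
  have lessThan: "{..<length l} = {..n}" using l by auto
  have form: "zp_null p (\<lambda>m. \<Sum>i\<le>n. zp_res p (a i) m * (x i m)\<^sup>2) \<longleftrightarrow>
      zp_null p (\<lambda>m. \<Sum>i\<le>n. c i * (s i m * x i m)\<^sup>2)" for x :: "nat \<Rightarrow> nat \<Rightarrow> int"
  proof (rule zp_null_cong)
    fix m
    have "int p ^ m dvd (zp_res p (a i) m - c i * (s i m)\<^sup>2) * (x i m)\<^sup>2" if "i \<le> n" for i
      using a[OF that, of m] by (simp add: c_def)
    then have "int p ^ m dvd (\<Sum>i\<le>n. (zp_res p (a i) m - c i * (s i m)\<^sup>2) * (x i m)\<^sup>2)"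
      by (intro dvd_sum) simp
    then show "int p ^ m dvd (\<Sum>i\<le>n. zp_res p (a i) m * (x i m)\<^sup>2) - (\<Sum>i\<le>n. c i * (s i m * x i m)\<^sup>2)"
      by (simp add: sum_subtractf[symmetric] algebra_simps power_mult_distrib)
  qed
  show ?thesis
  proof
    assume "has_Qp_point p n 2 a"
    then obtain x where x': "(\<forall>i\<le>n. zp_coherent p (x i)) \<and> (\<exists>i\<le>n. \<not> zp_null p (x i)) \<and>
         zp_null p (\<lambda>m. \<Sum>i\<le>n. zp_res p (a i) m * (x i m)\<^sup>2)"
      unfolding has_Qp_point_iff_coherent[OF p] by (rule exE)
    then obtain i0 where x: "\<And>i. i \<le> n \<Longrightarrow> zp_coherent p (x i)" "i0 \<le> n" "\<not> zp_null p (x i0)"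
      "zp_null p (\<lambda>m. \<Sum>i\<le>n. zp_res p (a i) m * (x i m)\<^sup>2)"
      by auto
    \<comment> \<open>The coordinate that turns out to be a unit is not known beforehand, so the
      precision must suffice for every exponent.\<close>
    define M where "M = hensel_exp p + (\<Sum>i\<le>n. fst (l ! i))"
    obtain y i where y: "i \<in> {..n}" "\<not> int p dvd y i" "int p ^ M dvd (\<Sum>i\<le>n. c i * (y i)\<^sup>2)"
    proof (rule zp_primitive_solution[OF p, where I = "{..n}" and x = "\<lambda>i m. s i m * x i m" and c = c and M = M])
      show "zp_null p (\<lambda>m. \<Sum>i\<in>{..n}. c i * (s i m * x i m)\<^sup>2)" using x(4) form by simp
      show "\<not> zp_null p (\<lambda>m. s i0 m * x i0 m)"
        using x s by (intro zp_not_null_mult[OF p]) auto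
    qed (use x s in \<open>auto intro: zp_coherent_mult\<close>)
    have "fst (l ! i) \<le> (\<Sum>i\<le>n. fst (l ! i))"
      using y(1) by (intro member_le_sum) auto
    then have "int p ^ (hensel_exp p + fst (l ! i)) dvd int p ^ M"
      by (intro le_imp_power_dvd) (simp add: M_def)
    then have "int p ^ (hensel_exp p + fst (l ! i)) dvd (\<Sum>i\<le>n. c i * (y i)\<^sup>2)"
      using y(3) dvd_trans by blast
    then show "diag_quad_iso p l"
      using y(1,2) l unfolding diag_quad_iso_def lessThan c_def
      by (intro exI[where x = y] exI[where x = i]) auto
  next
    assume "diag_quad_iso p l"
    then obtain x where "\<exists>i<length l. \<not> int p dvd x i \<and>
       int p ^ (hensel_exp p + fst (l ! i)) dvd (\<Sum>j\<le>n. c j * (x j)\<^sup>2)"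
      unfolding diag_quad_iso_def lessThan c_def[symmetric] by (rule exE)
    then obtain i where x: "i \<le> n" "\<not> int p dvd x i"
      "int p ^ (hensel_exp p + fst (l ! i)) dvd (\<Sum>j\<le>n. c j * (x j)\<^sup>2)"
      using l by (auto simp: less_Suc_eq_le)
    have "(\<Sum>j\<le>n. c j * (x j)\<^sup>2) = (\<Sum>j\<in>{..n}-{i}. c j * (x j)\<^sup>2) + c i * (x i)\<^sup>2"
      using x(1) by (subst sum.remove[of _ i]) auto
    moreover define S where "S = (\<Sum>j\<in>{..n}-{i}. c j * (x j)\<^sup>2)"
    ultimately have S: "int p ^ (hensel_exp p + fst (l ! i)) dvd S + c i * (x i)\<^sup>2"
      using x(3) by simp
    \<comment> \<open>The remaining terms share the factor p^e of the i-th coefficient; dividing by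
      it leaves a square root problem with unit coefficient and constant target
      \<open>- T\<close>.\<close>
    have "int p ^ fst (l ! i) dvd S + c i * (x i)\<^sup>2"
      using S by (metis dvd_mult_right power_add)
    then have "int p ^ fst (l ! i) dvd S"
      by (simp add: c_def dvd_add_left_iff mult.assoc)
    then obtain T where T: "S = int p ^ fst (l ! i) * T" by (auto elim: dvdE)
    have "int p ^ fst (l ! i) * int p ^ hensel_exp p dvd
        int p ^ fst (l ! i) * (snd (l ! i) * (x i)\<^sup>2 - (- T))"
      using S unfolding T c_def power_add by (simp add: algebra_simps)
    then have "int p ^ hensel_exp p dvd snd (l ! i) * (x i)\<^sup>2 - (- T)"
      using p prime_gt_0_nat[of p] by (subst (asm) dvd_mult_cancel_left) auto
    then obtain y where y: "zp_coherent p y" "\<And>m. int p ^ m dvd snd (l ! i) * (y m)\<^sup>2 - (- T)"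
        "\<And>m. \<not> int p dvd y m"
      using hensel_sqrt[OF p zp_coherent_const[of p "- T"] unit[OF x(1)] x(2)] by metis
    define z where "z j = (if j = i then y else (\<lambda>_. x j))" for j
    have z: "zp_coherent p (z j)" for j
      using y(1) by (simp add: z_def zp_coherent_const)
    have znull: "zp_null p (\<lambda>m. \<Sum>j\<le>n. c j * (z j m)\<^sup>2)"
      unfolding zp_null_def
    proof
      fix m
      have "(\<Sum>j\<le>n. c j * (z j m)\<^sup>2) = (\<Sum>j\<in>{..n}-{i}. c j * (z j m)\<^sup>2) + c i * (z i m)\<^sup>2"
        using x(1) by (subst sum.remove[of _ i]) auto
      also have "(\<Sum>j\<in>{..n}-{i}. c j * (z j m)\<^sup>2) = S"
        unfolding S_def by (intro sum.cong) (auto simp: z_def)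
      also have "S + c i * (z i m)\<^sup>2 = int p ^ fst (l ! i) * (snd (l ! i) * (y m)\<^sup>2 - (- T))"
        unfolding T c_def by (simp add: z_def algebra_simps)
      finally show "int p ^ m dvd (\<Sum>j\<le>n. c j * (z j m)\<^sup>2)"
        using y(2) by simp
    qed
    \<comment> \<open>Multiplying through by all the \<open>s j\<close> avoids dividing by them.\<close>
    define w where "w j m = z j m * (\<Prod>k\<in>{..n}-{j}. s k m)" for j m
    have wc: "zp_coherent p (w j)" for j
      unfolding w_def using s(1) by (intro zp_coherent_mult z zp_coherent_prod) simp
    have wi: "\<not> zp_null p (w i)"
      unfolding w_def
    proof (rule zp_not_null_mult[OF p])
      show "\<not> zp_null p (z i)" using y(3) by (intro zp_not_nullI) (simp add: z_def)
      show "\<not> zp_null p (\<lambda>m. \<Prod>k\<in>{..n} - {i}. s k m)"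
        by (rule zp_not_null_prod[OF p]) (simp_all add: s)
      show "zp_coherent p (\<lambda>m. \<Prod>k\<in>{..n} - {i}. s k m)"
        by (rule zp_coherent_prod) (simp add: s)
    qed (rule z)
    have "zp_null p (\<lambda>m. \<Sum>j\<le>n. c j * (s j m * w j m)\<^sup>2)"
      unfolding zp_null_def
    proof
      fix m
      have "s j m * w j m = z j m * (\<Prod>k\<le>n. s k m)" if "j \<le> n" for j
        using that by (simp add: w_def prod.remove[of _ j "\<lambda>k. s k m"] ac_simps)
      then have "(\<Sum>j\<le>n. c j * (s j m * w j m)\<^sup>2) = (\<Sum>j\<le>n. c j * (z j m)\<^sup>2) * (\<Prod>k\<le>n. s k m)\<^sup>2"
        unfolding sum_distrib_right by (intro sum.cong) (simp_all add: power_mult_distrib)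
      then show "int p ^ m dvd (\<Sum>j\<le>n. c j * (s j m * w j m)\<^sup>2)"
        using znull by (simp add: zp_null_def)
    qed
    then show "has_Qp_point p n 2 a"
      unfolding has_Qp_point_iff_coherent[OF p] form[of w, symmetric] using wc wi x(1)
      by (intro exI[where x = w] conjI allI impI exI[where x = i])
  qed
qed

section \<open>The measure of the insoluble coefficients\<close>

lemma prod_list_map_eq_prod_nth:
  "prod_list (map f l) = (\<Prod>i<length l. f (l ! i) :: 'a :: comm_monoid_mult)"
  by (induction l) (simp_all add: prod.lessThan_Suc_shift del: prod.lessThan_Suc)

section \<open>Haar measure of residue cylinders\<close>

lemma space_zp_measure: "space (zp_measure p) = zp_digits p"
  by (auto simp: zp_measure_def zp_digits_def space_PiM PiE_def space_uniform_count_measure)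

lemma prob_space_zp_measure:
  assumes "0 < p"
  shows "prob_space (zp_measure p)"
  unfolding zp_measure_def using assms
  by (intro prob_space_PiM prob_space_uniform_count_measure) auto

lemma zp_res_eq_iff:
  assumes "d \<in> zp_digits p" "w \<in> zp_digits p"
  shows "zp_res p d m = zp_res p w m \<longleftrightarrow> (\<forall>j<m. d j = w j)"
proof
  have p: "0 < int p" using assms(1) by (auto simp: zp_digits_def intro: gr0I)
  show "zp_res p d m = zp_res p w m \<Longrightarrow> \<forall>j<m. d j = w j"
  proof (induction m)
    case (Suc m)
    have "zp_res p v (Suc m) mod int p ^ m = zp_res p v m" if "v \<in> zp_digits p" for v
      using zp_res_less[OF that, of m] zp_res_nonneg[of p v m] by (simp add: zp_res_Suc)
    with Suc.prems assms have eq: "zp_res p d m = zp_res p w m" by metis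
    with Suc.prems have "int (d m) * int p ^ m = int (w m) * int p ^ m"
      by (simp add: zp_res_Suc)
    with p have "d m = w m" by simp
    with Suc.IH[OF eq] show ?case by (auto simp: less_Suc_eq)
  qed simp
qed (simp add: zp_res_def)

text \<open>Fixing the residue modulo p^m amounts to fixing the first m digits, each of probability
  1/p.\<close>

lemma
  assumes "0 < p" "0 \<le> u" "u < int p ^ m"
  shows sets_zp_cylinder: "{d \<in> zp_digits p. zp_res p d m = u} \<in> sets (zp_measure p)" (is ?A)
    and measure_zp_cylinder: "measure (zp_measure p) {d \<in> zp_digits p. zp_res p d m = u} = 1 / real p ^ m" (is ?B)
proof -
  let ?M = "\<lambda>_::nat. uniform_count_measure {..<p}"
  obtain w where w: "w \<in> zp_digits p" "\<And>m. zp_res p w m = u mod int p ^ m"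
    using zp_digits_of_coherent[OF assms(1) zp_coherent_const] by metis
  have "zp_res p w m = u" using w assms(2,3) by simp
  then have "{d \<in> zp_digits p. zp_res p d m = u} = {d \<in> zp_digits p. \<forall>j<m. d j = w j}"
    using zp_res_eq_iff[OF _ w(1), of _ m] by auto
  also have "\<dots> = prod_emb UNIV ?M {..<m} (\<Pi>\<^sub>E j\<in>{..<m}. {w j})"
    by (auto simp: prod_emb_def zp_digits_def space_PiM PiE_def Pi_iff space_uniform_count_measure)
  finally have eq: "{d \<in> zp_digits p. zp_res p d m = u} = prod_emb UNIV ?M {..<m} (\<Pi>\<^sub>E j\<in>{..<m}. {w j})" .
  have wp: "w j < p" for j using w(1) by (simp add: zp_digits_def)
  interpret product_prob_space ?M UNIV
    using assms(1) by (intro product_prob_spaceI prob_space_uniform_count_measure) auto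
  show ?A
    unfolding eq zp_measure_def
    by (intro sets_PiM_I) (auto simp: sets_uniform_count_measure wp)
  have "measure (zp_measure p) {d \<in> zp_digits p. zp_res p d m = u} = (\<Prod>j<m. measure (?M j) {w j})"
    unfolding eq zp_measure_def
    by (intro measure_PiM_emb) (auto simp: sets_uniform_count_measure wp)
  also have "\<dots> = 1 / real p ^ m"
    by (simp add: measure_uniform_count_measure wp power_one_over[symmetric] divide_inverse power_inverse)
  finally show ?B .
qed

text \<open>If i < j, reduction modulo p^(i+1) annihilates the second expression but not the first;
  \<open>0 < k\<close> makes both truncations deep enough to be compared there.\<close>

lemma zp_leading_term_unique:
  assumes "prime p" "0 < k"
    and "zp_res p d (i + k) = int p ^ i * u" "zp_res p d (j + k) = int p ^ j * v"
    and "\<not> int p dvd u" "\<not> int p dvd v"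
  shows "i = j \<and> u = v"
proof -
  have less: False
    if "i < j" "zp_res p d (i + k) = int p ^ i * u" "zp_res p d (j + k) = int p ^ j * v" "\<not> int p dvd u"
    for i j u v
  proof -
    have "int p ^ Suc i dvd int p ^ j * v"
      using that(1) by (intro dvd_mult2 le_imp_power_dvd) simp
    moreover have "int p ^ Suc i dvd int p ^ j * v - int p ^ i * u"
    proof -
      have "int p ^ (i + k) dvd int p ^ j * v - int p ^ i * u"
        using zp_coherent_le[OF zp_coherent_zp_res, of "i + k" "j + k" p d] that by simp
      moreover have "int p ^ Suc i dvd int p ^ (i + k)"
        using assms(2) by (intro le_imp_power_dvd) simp
      ultimately show ?thesis using dvd_trans by blast
    qed
    ultimately have "int p ^ Suc i dvd int p ^ i * u"
      using dvd_diff_imp_dvd_iff by blast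
    then have "int p ^ i * int p dvd int p ^ i * u" by (simp add: mult.commute)
    then have "int p dvd u"
      using assms(1) prime_gt_0_nat[of p] by (subst (asm) dvd_mult_cancel_left) auto
    with that(4) show False by blast
  qed
  have "i = j" using less[of i j u v] less[of j i v u] assms(3-) by (metis linorder_neqE_nat)
  moreover have "int p ^ i \<noteq> 0" using assms(1) prime_gt_0_nat[of p] by simp
  ultimately show ?thesis using assms(3,4) by (metis mult_cancel_left)
qed

text \<open>The valuation is the index of the first nonzero digit, and that digit, lying strictly
  between 0 and p, is prime to p.\<close>

lemma zp_leading_term_exists:
  assumes "prime p" "0 < k" "d \<in> zp_digits p" "d j \<noteq> 0"
  obtains i u where "zp_res p d (i + k) = int p ^ i * u" "0 \<le> u" "u < int p ^ k" "\<not> int p dvd u"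
proof -
  have p: "0 < int p" using assms(1) prime_gt_0_nat[of p] by simp
  define i where "i = (LEAST i. d i \<noteq> 0)"
  have i: "d i \<noteq> 0" unfolding i_def using assms(4) by (rule LeastI)
  have "d n = 0" if "n < i" for n using not_less_Least that unfolding i_def by blast
  then have "zp_res p d i = 0" by (simp add: zp_res_def)
  then have "int p ^ i dvd zp_res p d (i + k)"
    using zp_coherent_le[OF zp_coherent_zp_res, of i "i + k" p d] by simp
  then obtain u where u: "zp_res p d (i + k) = int p ^ i * u" by (auto elim: dvdE)
  have "0 \<le> int p ^ i * u" using zp_res_nonneg[of p d "i + k"] u by simp
  then have "0 \<le> u" using zero_less_power[OF p, of i] by (auto simp: zero_le_mult_iff)
  have "int p ^ i * u < int p ^ i * int p ^ k"
    using zp_res_less[OF assms(3), of "i + k"] u by (simp add: power_add)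
  then have "u < int p ^ k" using p by simp
  have "\<not> int p dvd u"
  proof
    assume "int p dvd u"
    then have "int p ^ Suc i dvd zp_res p d (i + k)" unfolding u by (simp add: mult.commute)
    moreover have "int p ^ Suc i dvd zp_res p d (i + k) - zp_res p d (Suc i)"
      using assms(2) by (intro zp_coherent_le zp_coherent_zp_res) simp
    ultimately have "int p ^ Suc i dvd zp_res p d (Suc i)"
      using dvd_diff_imp_dvd_iff by blast
    then have "int p ^ i * int p dvd int p ^ i * int (d i)"
      using \<open>zp_res p d i = 0\<close> by (simp add: zp_res_Suc mult.commute)
    then have "int p dvd int (d i)"
      using p by (subst (asm) dvd_mult_cancel_left) auto
    then have "p dvd d i" by simp
    then show False using i assms(3) by (auto simp: zp_digits_def dest: nat_dvd_not_less)
  qed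
  with u \<open>0 \<le> u\<close> \<open>u < int p ^ k\<close> show thesis by (rule that)
qed

text \<open>For a unit \<open>t\<close>, these are the residues of the units in its square class, at
  the precision where Hensel's lemma lets the residue decide the class.\<close>

definition square_class_residues :: "nat \<Rightarrow> int \<Rightarrow> int set" where
  "square_class_residues p t = {u \<in> {0..<int p ^ hensel_exp p}. \<not> int p dvd u \<and>
     (\<exists>x. int p ^ hensel_exp p dvd t * x\<^sup>2 - u)}"

lemma hensel_exp_pos: "0 < hensel_exp p"
  by (simp add: hensel_exp_def)

text \<open>The pair \<open>(e, t)\<close> stands for the square class of \<open>p ^ e * r t\<close> in the multiplicative group
  of the \<open>p\<close>-adic numbers.\<close>

locale square_classes =
  fixes p :: nat and T :: "'i set" and r :: "'i \<Rightarrow> int" and N :: nat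
  assumes p: "prime p"
    and finite_T: "finite T"
    and unit: "t \<in> T \<Longrightarrow> \<not> int p dvd r t"
    and disjoint: "s \<in> T \<Longrightarrow> t \<in> T \<Longrightarrow>
      u \<in> square_class_residues p (r s) \<Longrightarrow> u \<in> square_class_residues p (r t) \<Longrightarrow> s = t"
    and cover: "0 \<le> u \<Longrightarrow> u < int p ^ hensel_exp p \<Longrightarrow> \<not> int p dvd u \<Longrightarrow>
      \<exists>t\<in>T. u \<in> square_class_residues p (r t)"
    and card_residues: "t \<in> T \<Longrightarrow> card (square_class_residues p (r t)) = N"
begin

definition sq_classes :: "(nat \<times> 'i) set" where
  "sq_classes = {c. fst c < 2 \<and> snd c \<in> T}"

text \<open>The valuation may exceed \<open>fst c\<close> by any \<open>2 * h\<close>, since p^(2h)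
  is a square.\<close>

definition class_set :: "nat \<times> 'i \<Rightarrow> (nat \<Rightarrow> nat) set" where
  "class_set c = {d \<in> zp_digits p. \<exists>h. \<exists>u\<in>square_class_residues p (r (snd c)).
     zp_res p d (fst c + 2 * h + hensel_exp p) = int p ^ (fst c + 2 * h) * u}"

text \<open>For each h there are \<open>N\<close> cylinders of measure p^-(e + 2h + L), with e =
  \<open>fst c\<close> and L = \<open>hensel_exp p\<close>; the last factor sums the geometric
  series over h.\<close>

definition class_weight :: "nat \<times> 'i \<Rightarrow> real" where
  "class_weight c = real N / real p ^ (fst c + hensel_exp p) / (1 - 1 / real p ^ 2)"

definition anisotropic_lists :: "nat \<Rightarrow> (nat \<times> 'i) list set" where
  "anisotropic_lists k = {l. length l = k \<and> set l \<subseteq> sq_classes \<and>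
     \<not> diag_quad_iso p (map (\<lambda>c. (fst c, r (snd c))) l)}"

lemma p_pos: "0 < p"
  using p by (rule prime_gt_0_nat)

lemma class_set_exists:
  assumes "d \<in> zp_digits p" "d j \<noteq> 0"
  shows "\<exists>c\<in>sq_classes. d \<in> class_set c"
proof -
  obtain i u where u: "zp_res p d (i + hensel_exp p) = int p ^ i * u"
    "0 \<le> u" "u < int p ^ hensel_exp p" "\<not> int p dvd u"
    using zp_leading_term_exists[OF p hensel_exp_pos assms] .
  obtain t where t: "t \<in> T" "u \<in> square_class_residues p (r t)"
    using cover[OF u(2-4)] by blast
  have "d \<in> class_set (i mod 2, t)"
    unfolding class_set_def using assms(1) u(1) t(2)
    by (auto intro!: exI[of _ "i div 2"] bexI[of _ u])
  moreover have "(i mod 2, t) \<in> sq_classes" using t(1) by (auto simp: sq_classes_def)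
  ultimately show ?thesis by blast
qed

lemma class_set_unique:
  assumes "c \<in> sq_classes" "c' \<in> sq_classes" "d \<in> class_set c" "d \<in> class_set c'"
  shows "c = c'"
proof -
  obtain h u where u: "u \<in> square_class_residues p (r (snd c))"
    "zp_res p d (fst c + 2 * h + hensel_exp p) = int p ^ (fst c + 2 * h) * u"
    using assms(3) unfolding class_set_def by blast
  obtain h' u' where u': "u' \<in> square_class_residues p (r (snd c'))"
    "zp_res p d (fst c' + 2 * h' + hensel_exp p) = int p ^ (fst c' + 2 * h') * u'"
    using assms(4) unfolding class_set_def by blast
  have "fst c + 2 * h = fst c' + 2 * h' \<and> u = u'"
    using u u' by (intro zp_leading_term_unique[OF p hensel_exp_pos])
      (auto simp: square_class_residues_def)
  then have eq: "fst c + 2 * h = fst c' + 2 * h'" "u = u'" by auto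
  have "(fst c + 2 * h) mod 2 = (fst c' + 2 * h') mod 2" using eq(1) by simp
  then have "fst c = fst c'" using assms(1,2) by (auto simp: sq_classes_def)
  moreover have "snd c = snd c'"
    using disjoint[of "snd c" "snd c'" u] assms(1,2) u(1) u'(1) eq(2) by (auto simp: sq_classes_def)
  ultimately show ?thesis by (rule prod_eqI)
qed

text \<open>Removing p^(e+2h) leaves a unit with a leading residue in the class of
  \<open>r (snd c)\<close>. Hensel's lemma writes that unit as \<open>r (snd c)\<close> times a
  square, and p^h returns to the square root.\<close>

lemma class_set_square:
  assumes "snd c \<in> T" "d \<in> class_set c"
  shows "\<exists>s. zp_coherent p s \<and> \<not> zp_null p s \<and>
    (\<forall>m. int p ^ m dvd zp_res p d m - int p ^ fst c * r (snd c) * (s m)\<^sup>2)"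
proof -
  obtain h u where u: "u \<in> square_class_residues p (r (snd c))"
    "zp_res p d (fst c + 2 * h + hensel_exp p) = int p ^ (fst c + 2 * h) * u"
    using assms(2) unfolding class_set_def by blast
  define k where "k = fst c + 2 * h"
  have pk: "int p ^ k \<noteq> 0" using p_pos by simp
  obtain x where x: "int p ^ hensel_exp p dvd r (snd c) * x\<^sup>2 - u" and pu: "\<not> int p dvd u"
    using u(1) by (auto simp: square_class_residues_def)
  have coh: "int p ^ k dvd zp_res p d (m + k)" for m
  proof -
    have "int p ^ k dvd zp_res p d (k + hensel_exp p) - zp_res p d k"
      by (intro zp_coherent_le zp_coherent_zp_res) simp
    then have "int p ^ k dvd zp_res p d k"
      using u(2) dvd_diff_imp_dvd_iff unfolding k_def[symmetric] by (metis dvd_triv_left)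
    moreover have "int p ^ k dvd zp_res p d (m + k) - zp_res p d k"
      by (intro zp_coherent_le zp_coherent_zp_res) simp
    ultimately show ?thesis using dvd_diff_imp_dvd_iff by blast
  qed
  \<comment> \<open>\<open>n\<close> is the unit part of \<open>d\<close>; reading \<open>d\<close>
    k levels deeper pays for the division by p^k.\<close>
  then obtain n where n: "\<And>m. zp_res p d (m + k) = int p ^ k * n m"
    unfolding dvd_def by metis
  have "zp_coherent p n"
    unfolding zp_coherent_def
  proof
    fix m
    have "int p ^ (m + k) dvd zp_res p d (Suc m + k) - zp_res p d (m + k)"
      by (intro zp_coherent_le zp_coherent_zp_res) simp
    then have "int p ^ k * int p ^ m dvd int p ^ k * (n (Suc m) - n m)"
      unfolding n power_add by (simp add: right_diff_distrib mult.commute)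
    then show "int p ^ m dvd n (Suc m) - n m"
      using pk by (subst (asm) dvd_mult_cancel_left) auto
  qed
  have nL: "n (hensel_exp p) = u"
    using n[of "hensel_exp p"] u(2) pk unfolding k_def[symmetric] add.commute[of k]
    by (metis mult_cancel_left)
  have "\<not> int p dvd x"
  proof
    assume "int p dvd x"
    then have "int p dvd r (snd c) * x\<^sup>2" by (simp add: power2_eq_square)
    moreover have "int p dvd r (snd c) * x\<^sup>2 - u"
      using x hensel_exp_pos by (metis dvd_trans dvd_power)
    ultimately show False using pu dvd_diff_imp_dvd_iff by blast
  qed
  then obtain y where y: "zp_coherent p y" "\<And>m. int p ^ m dvd r (snd c) * (y m)\<^sup>2 - n m"
    "\<And>m. \<not> int p dvd y m"
    using hensel_sqrt[OF p \<open>zp_coherent p n\<close> unit[OF assms(1)]] x nL by metis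
  define s where "s m = int p ^ h * y m" for m
  have "zp_coherent p s"
    unfolding s_def by (intro zp_coherent_mult y(1) zp_coherent_const)
  moreover have "\<not> zp_null p s"
    unfolding s_def
  proof (rule zp_not_null_mult[OF p zp_coherent_const y(1)])
    have "\<not> int p ^ Suc h dvd int p ^ h"
    proof
      assume "int p ^ Suc h dvd int p ^ h"
      then have "int p ^ h * int p dvd int p ^ h * 1" by (simp add: mult.commute)
      then have "int p dvd 1" using p_pos by (subst (asm) dvd_mult_cancel_left) auto
      then show False using p by auto
    qed
    then show "\<not> zp_null p (\<lambda>_. int p ^ h)" unfolding zp_null_def by blast
    show "\<not> zp_null p y" using y(3) by (rule zp_not_nullI)
  qed
  moreover have "int p ^ m dvd zp_res p d m - int p ^ fst c * r (snd c) * (s m)\<^sup>2" for m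
  proof -
    have "int p ^ fst c * r (snd c) * (s m)\<^sup>2 = int p ^ k * (r (snd c) * (y m)\<^sup>2)"
      by (simp add: s_def k_def power_mult_distrib power_add power_mult[symmetric] ac_simps)
    then have "zp_res p d m - int p ^ fst c * r (snd c) * (s m)\<^sup>2
        = - (zp_res p d (m + k) - zp_res p d m) - int p ^ k * (r (snd c) * (y m)\<^sup>2 - n m)"
      by (simp only: n right_diff_distrib)
    moreover have "int p ^ m dvd zp_res p d (m + k) - zp_res p d m"
      by (intro zp_coherent_le zp_coherent_zp_res) simp
    ultimately show ?thesis using y(2)[of m] by (metis dvd_diff dvd_minus_iff dvd_mult)
  qed
  ultimately show ?thesis by blast
qed

lemma
  assumes "snd c \<in> T"
  shows sets_class_set: "class_set c \<in> sets (zp_measure p)"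
    and measure_class_set: "measure (zp_measure p) (class_set c) = class_weight c"
proof -
  interpret prob_space "zp_measure p" using prob_space_zp_measure[OF p_pos] .
  let ?U = "square_class_residues p (r (snd c))" and ?L = "hensel_exp p"
  define C where "C h u = {d \<in> zp_digits p. zp_res p d (fst c + 2 * h + ?L) = int p ^ (fst c + 2 * h) * u}" for h u
  define A where "A h = (\<Union>u\<in>?U. C h u)" for h
  have finU: "finite ?U" by (rule finite_subset[of _ "{0..<int p ^ ?L}"]) (auto simp: square_class_residues_def)
  have bound: "0 \<le> int p ^ (fst c + 2 * h) * u" "int p ^ (fst c + 2 * h) * u < int p ^ (fst c + 2 * h + ?L)"
    if "u \<in> ?U" for u h
    using that p_pos by (auto simp: square_class_residues_def power_add)
  have C: "C h u \<in> sets (zp_measure p)" "measure (zp_measure p) (C h u) = 1 / real p ^ (fst c + 2 * h + ?L)"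
    if "u \<in> ?U" for h u
    unfolding C_def using sets_zp_cylinder[OF p_pos bound[OF that]] measure_zp_cylinder[OF p_pos bound[OF that]]
    by auto
  have A: "A h \<in> sets (zp_measure p)" for h
    unfolding A_def using finU C by (intro sets.finite_UN) auto
  have dC: "disjoint_family_on (C h) ?U" for h
    using p_pos by (auto simp: disjoint_family_on_def C_def)
  have mA: "measure (zp_measure p) (A h) = real N / real p ^ (fst c + ?L) * (1 / real p ^ 2) ^ h" for h
  proof -
    have "measure (zp_measure p) (A h) = (\<Sum>u\<in>?U. measure (zp_measure p) (C h u))"
      unfolding A_def using finU C dC by (intro finite_measure_finite_Union) auto
    also have "\<dots> = real N / real p ^ (fst c + 2 * h + ?L)"
      using C(2) card_residues[OF assms] by simp
    also have "\<dots> = real N / real p ^ (fst c + ?L) * (1 / real p ^ 2) ^ h"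
      by (simp add: power_add power_mult power_one_over divide_simps)
    finally show ?thesis .
  qed
  have eq: "class_set c = (\<Union>h. A h)"
    by (auto simp: class_set_def A_def C_def)
  show "class_set c \<in> sets (zp_measure p)"
    unfolding eq using A by (intro sets.countable_UN) auto
  \<comment> \<open>Different \<open>h\<close> mean different valuations.\<close>
  have "disjoint_family A"
    unfolding disjoint_family_on_def
  proof (intro ballI impI)
    fix h k :: nat
    assume "h \<noteq> k"
    have False if dA: "d \<in> A h" "d \<in> A k" for d
    proof -
      obtain u v where "u \<in> ?U" "v \<in> ?U" "zp_res p d (fst c + 2 * h + ?L) = int p ^ (fst c + 2 * h) * u"
        "zp_res p d (fst c + 2 * k + ?L) = int p ^ (fst c + 2 * k) * v"
        using dA unfolding A_def C_def by blast
      then have "fst c + 2 * h = fst c + 2 * k \<and> u = v"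
        by (intro zp_leading_term_unique[OF p hensel_exp_pos]) (auto simp: square_class_residues_def)
      then show False using \<open>h \<noteq> k\<close> by simp
    qed
    then show "A h \<inter> A k = {}" by blast
  qed
  then have "(\<lambda>h. measure (zp_measure p) (A h)) sums measure (zp_measure p) (class_set c)"
    unfolding eq using A by (intro finite_measure_UNION) auto
  moreover have "(\<lambda>h. measure (zp_measure p) (A h)) sums class_weight c"
  proof -
    have "1 < p" using p by (rule prime_gt_1_nat)
    then have "norm (1 / real p ^ 2) < 1" by (simp add: power_less_one_iff divide_simps one_less_power)
    from sums_mult[OF geometric_sums[OF this], of "real N / real p ^ (fst c + ?L)"]
    show ?thesis unfolding mA class_weight_def by simp
  qed
  ultimately show "measure (zp_measure p) (class_set c) = class_weight c"
    by (rule sums_unique2)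
qed

section \<open>The insoluble set as a union of boxes of square classes\<close>

lemma finite_sq_classes: "finite sq_classes"
proof (rule finite_subset)
  show "sq_classes \<subseteq> {..<2} \<times> T" by (auto simp: sq_classes_def)
qed (simp add: finite_T)

lemma finite_anisotropic_lists: "finite (anisotropic_lists k)"
proof (rule finite_subset)
  show "anisotropic_lists k \<subseteq> {l. set l \<subseteq> sq_classes \<and> length l = k}"
    by (auto simp: anisotropic_lists_def)
  show "finite {l. set l \<subseteq> sq_classes \<and> length l = k}"
    using finite_sq_classes by (rule finite_lists_length_eq)
qed

lemma has_Qp_point_class_iff:
  assumes "length l = Suc n" "set l \<subseteq> sq_classes" "\<And>i. i \<le> n \<Longrightarrow> a i \<in> class_set (l ! i)"
  shows "has_Qp_point p n 2 a \<longleftrightarrow> diag_quad_iso p (map (\<lambda>c. (fst c, r (snd c))) l)"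
proof -
  have T: "snd (l ! i) \<in> T" if "i \<le> n" for i
    using assms(1,2) that nth_mem[of i l] by (fastforce simp: sq_classes_def)
  have "\<forall>i. \<exists>s. i \<le> n \<longrightarrow> (zp_coherent p s \<and> \<not> zp_null p s \<and>
    (\<forall>m. int p ^ m dvd zp_res p (a i) m - int p ^ fst (l ! i) * r (snd (l ! i)) * (s m)\<^sup>2))"
    using class_set_square[OF T assms(3)] by blast
  from choice[OF this] obtain s where s: "\<And>i. i \<le> n \<Longrightarrow> (zp_coherent p (s i) \<and> \<not> zp_null p (s i) \<and>
    (\<forall>m. int p ^ m dvd zp_res p (a i) m - int p ^ fst (l ! i) * r (snd (l ! i)) * (s i m)\<^sup>2))"
    by blast
  show ?thesis
    by (rule has_Qp_point_iff_diag_quad_iso[OF p, where s = s])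
      (use assms(1) s unit T in \<open>auto simp: less_Suc_eq_le\<close>)
qed

text \<open>Zero is the one p-adic integer without a square class. The i-th unit vector is then a
  point, so such coefficients never enter the insoluble set.\<close>

lemma has_Qp_point_zero_coeff:
  assumes "i \<le> n" "\<And>j. a i j = 0"
  shows "has_Qp_point p n 2 a"
  unfolding has_Qp_point_iff_coherent[OF p]
proof (rule exI[where x = "\<lambda>j _. if j = i then 1 else 0"], intro conjI allI impI)
  show "zp_coherent p (\<lambda>_. if j = i then 1 else 0)" for j by (rule zp_coherent_const)
  have "\<not> int p dvd 1" using p by auto
  then show "\<exists>j\<le>n. \<not> zp_null p (\<lambda>_. if j = i then 1 else 0)"
    using assms(1) by (intro exI[of _ i]) (auto intro!: zp_not_nullI)
  have "(\<Sum>j\<le>n. zp_res p (a j) m * (if j = i then 1 else 0)\<^sup>2) = 0" for m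
    using assms by (intro sum.neutral) (auto simp: zp_res_def)
  then show "zp_null p (\<lambda>m. \<Sum>j\<le>n. zp_res p (a j) m * (if j = i then 1 else 0)\<^sup>2)"
    by (simp add: zp_null_def)
qed

text \<open>Solubility depends only on the tuple of classes, so the insoluble set is a union of
  whole boxes. The index set being finite, this also yields measurability.\<close>

lemma no_Qp_point_eq_UN_class_sets:
  "{a \<in> space (zp_vec_measure p n). \<not> has_Qp_point p n 2 a} =
   (\<Union>l\<in>anisotropic_lists (Suc n). \<Pi>\<^sub>E i\<in>{..n}. class_set (l ! i))" (is "?A = ?B")
proof (intro equalityI subsetI)
  fix a assume a: "a \<in> ?A"
  then have dig: "a \<in> (\<Pi>\<^sub>E i\<in>{..n}. zp_digits p)"
    by (simp add: zp_vec_measure_def space_PiM space_zp_measure)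
  have "\<exists>c\<in>sq_classes. a i \<in> class_set c" if "i \<le> n" for i
    using class_set_exists[of "a i"] has_Qp_point_zero_coeff[OF that, of a] dig a that
    by (metis (no_types, lifting) PiE_mem atMost_iff mem_Collect_eq)
  then obtain c where c: "\<And>i. i \<le> n \<Longrightarrow> c i \<in> sq_classes \<and> a i \<in> class_set (c i)"
    by metis
  define l where "l = map c [0..<Suc n]"
  have l: "length l = Suc n" "set l \<subseteq> sq_classes" "\<And>i. i \<le> n \<Longrightarrow> a i \<in> class_set (l ! i)"
    using c by (auto simp: l_def less_Suc_eq_le simp del: upt_Suc)
  have "l \<in> anisotropic_lists (Suc n)"
    using l has_Qp_point_class_iff[OF l] a by (simp add: anisotropic_lists_def)
  moreover have "a \<in> (\<Pi>\<^sub>E i\<in>{..n}. class_set (l ! i))"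
    using dig l(3) by (auto simp: PiE_def)
  ultimately show "a \<in> ?B" by blast
next
  fix a assume "a \<in> ?B"
  then obtain l where l: "l \<in> anisotropic_lists (Suc n)" "a \<in> (\<Pi>\<^sub>E i\<in>{..n}. class_set (l ! i))"
    by blast
  have "a \<in> space (zp_vec_measure p n)"
    using l(2) by (auto simp: zp_vec_measure_def space_PiM space_zp_measure class_set_def PiE_def Pi_def)
  moreover have "\<not> has_Qp_point p n 2 a"
    using l has_Qp_point_class_iff[of l n a] by (auto simp: anisotropic_lists_def)
  ultimately show "a \<in> ?A" by simp
qed

text \<open>Distinct lists differ in some coordinate, where their class sets are disjoint; hence the
  boxes are disjoint and each has the product of its class weights as measure.\<close>

theorem rho_eq_sum_anisotropic_lists:
  "rho p n 2 = 1 - (\<Sum>l\<in>anisotropic_lists (Suc n). prod_list (map class_weight l))"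
proof -
  interpret Z: prob_space "zp_measure p" using prob_space_zp_measure[OF p_pos] .
  interpret V: product_prob_space "\<lambda>_. zp_measure p" "{..n}"
    by (intro product_prob_spaceI Z.prob_space_axioms)
  interpret F: finite_product_prob_space "\<lambda>_. zp_measure p" "{..n}"
    by standard simp
  define F where "F l = (\<Pi>\<^sub>E i\<in>{..n}. class_set (l ! i))" for l
  let ?S = "anisotropic_lists (Suc n)"
  have T: "l ! i \<in> sq_classes" if "l \<in> ?S" "i \<le> n" for l i
    using that nth_mem[of i l] by (fastforce simp: anisotropic_lists_def)
  then have T': "snd (l ! i) \<in> T" if "l \<in> ?S" "i \<le> n" for l i
    using that by (auto simp: sq_classes_def)
  have sets: "F l \<in> sets (zp_vec_measure p n)" if "l \<in> ?S" for l
    unfolding F_def zp_vec_measure_def using T'[OF that] sets_class_set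
    by (intro sets_PiM_I_finite) auto
  have meas: "measure (zp_vec_measure p n) (F l) = prod_list (map class_weight l)" if "l \<in> ?S" for l
  proof -
    have "measure (zp_vec_measure p n) (F l) = (\<Prod>i\<le>n. measure (zp_measure p) (class_set (l ! i)))"
      unfolding F_def zp_vec_measure_def using T'[OF that] sets_class_set
      by (intro F.prob_times) auto
    also have "\<dots> = (\<Prod>i\<le>n. class_weight (l ! i))"
      using T'[OF that] measure_class_set by (intro prod.cong) auto
    also have "\<dots> = prod_list (map class_weight l)"
      using that by (auto simp: prod_list_map_eq_prod_nth anisotropic_lists_def lessThan_Suc_atMost)
    finally show ?thesis .
  qed
  have disj: "disjoint_family_on F ?S"
    unfolding disjoint_family_on_def
  proof (intro ballI impI)
    fix l l' assume ll: "l \<in> ?S" "l' \<in> ?S" "l \<noteq> l'"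
    have len: "length l = Suc n" "length l' = Suc n" using ll by (auto simp: anisotropic_lists_def)
    with ll(3) obtain i where i: "i \<le> n" "l ! i \<noteq> l' ! i"
      by (metis less_Suc_eq_le nth_equalityI)
    have "class_set (l ! i) \<inter> class_set (l' ! i) = {}"
      using class_set_unique[OF T[OF ll(1) i(1)] T[OF ll(2) i(1)]] i(2) by blast
    then show "F l \<inter> F l' = {}"
      using i(1) unfolding F_def PiE_Int by (metis PiE_eq_empty_iff atMost_iff)
  qed
  have bad: "{a \<in> space (zp_vec_measure p n). \<not> has_Qp_point p n 2 a} = (\<Union>l\<in>?S. F l)"
    unfolding F_def by (rule no_Qp_point_eq_UN_class_sets)
  have "rho p n 2 = measure (zp_vec_measure p n) (space (zp_vec_measure p n) - (\<Union>l\<in>?S. F l))"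
    unfolding rho_def bad[symmetric] by (rule arg_cong[where f = "measure _"]) auto
  also have "\<dots> = 1 - measure (zp_vec_measure p n) (\<Union>l\<in>?S. F l)"
    using sets finite_anisotropic_lists unfolding zp_vec_measure_def
    by (intro V.P.prob_compl sets.finite_UN) auto
  also have "measure (zp_vec_measure p n) (\<Union>l\<in>?S. F l) = (\<Sum>l\<in>?S. measure (zp_vec_measure p n) (F l))"
    using sets disj finite_anisotropic_lists unfolding zp_vec_measure_def
    by (intro V.P.finite_measure_finite_Union) auto
  also have "\<dots> = (\<Sum>l\<in>?S. prod_list (map class_weight l))"
    using meas by (intro sum.cong) auto
  finally show ?thesis .
qed

end

section \<open>Anisotropic tuples of square classes\<close>

text \<open>The new variable is set to 0. This monotonicity is what makes pruning the enumeration
  sound.\<close>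

lemma diag_quad_iso_Cons:
  assumes "diag_quad_iso p l"
  shows "diag_quad_iso p (c # l)"
proof -
  obtain x where x': "\<exists>i<length l. \<not> int p dvd x i \<and>
     int p ^ (hensel_exp p + fst (l ! i)) dvd
       (\<Sum>j<length l. int p ^ fst (l ! j) * snd (l ! j) * (x j)\<^sup>2)"
    using assms unfolding diag_quad_iso_def by (rule exE)
  then obtain i where x: "i < length l" "\<not> int p dvd x i"
    "int p ^ (hensel_exp p + fst (l ! i)) dvd
       (\<Sum>j<length l. int p ^ fst (l ! j) * snd (l ! j) * (x j)\<^sup>2)"
    by blast
  show ?thesis
    unfolding diag_quad_iso_def
    by (rule exI[where x = "case_nat 0 x"], rule exI[where x = "Suc i"])
      (use x in \<open>simp add: sum.lessThan_Suc_shift del: sum.lessThan_Suc\<close>)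
qed

text \<open>Sums over lists all of whose suffixes satisfy \<open>P\<close>, evaluated depth first so that
  simplification only ever sees one branch; the anisotropic lists are closed under suffixes.\<close>

primrec pruned_sum ::
  "('a list \<Rightarrow> bool) \<Rightarrow> ('a \<Rightarrow> 'b :: comm_semiring_1) \<Rightarrow> 'a list \<Rightarrow> nat \<Rightarrow> 'a list \<Rightarrow> 'b" where
  "pruned_sum P w cs 0 l = 1"
| "pruned_sum P w cs (Suc k) l =
    (\<Sum>c\<leftarrow>cs. if P (c # l) then w c * pruned_sum P w cs k (c # l) else 0)"

text \<open>\<open>P\<close> is an executable test for anisotropy, required to be correct only on
  lists of classes; \<open>cs\<close> fixes an order in which the classes are tried.\<close>

locale enumerated_square_classes = square_classes p T r N
  for p :: nat and T :: "'i set" and r :: "'i \<Rightarrow> int" and N :: nat +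
  fixes cs :: "(nat \<times> 'i) list" and P :: "(nat \<times> 'i) list \<Rightarrow> bool"
  assumes set_cs: "set cs = sq_classes" and distinct_cs: "distinct cs"
    and P_iff: "\<And>l. set l \<subseteq> sq_classes \<Longrightarrow>
      P l \<longleftrightarrow> \<not> diag_quad_iso p (map (\<lambda>c. (fst c, r (snd c))) l)"
begin

section \<open>Summation over the anisotropic lists\<close>

lemma anisotropic_lists_0: "anisotropic_lists 0 = {[]}"
  by (auto simp: anisotropic_lists_def diag_quad_iso_def)

lemma anisotropic_lists_Suc:
  "anisotropic_lists (Suc k) =
    (\<lambda>(l, c). c # l) ` {(l, c) \<in> anisotropic_lists k \<times> set cs. P (c # l)}"
proof -
  have "l \<in> anisotropic_lists (Suc k) \<longleftrightarrow>
      (\<exists>l' c. l = c # l' \<and> l' \<in> anisotropic_lists k \<and> c \<in> sq_classes \<and> P l)" for l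
  proof (cases l)
    case (Cons c l')
    then show ?thesis
      using P_iff[of l] diag_quad_iso_Cons[of p "map (\<lambda>c. (fst c, r (snd c))) l'" "(fst c, r (snd c))"]
      by (auto simp: anisotropic_lists_def)
  qed (simp add: anisotropic_lists_def)
  then show ?thesis unfolding set_cs by (auto simp: image_iff)
qed

lemma sum_anisotropic_lists_Suc:
  "(\<Sum>l\<in>anisotropic_lists (Suc k). F l) =
    (\<Sum>l\<in>anisotropic_lists k. \<Sum>c\<leftarrow>cs. if P (c # l) then F (c # l) else 0)"
proof -
  let ?D = "anisotropic_lists k \<times> set cs"
  have "(\<Sum>l\<in>anisotropic_lists (Suc k). F l) = (\<Sum>(l, c)\<in>{(l, c) \<in> ?D. P (c # l)}. F (c # l))"
    unfolding anisotropic_lists_Suc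
    by (subst sum.reindex) (auto simp: inj_on_def case_prod_unfold)
  also have "\<dots> = (\<Sum>(l, c)\<in>?D. if P (c # l) then F (c # l) else 0)"
    using finite_anisotropic_lists
    by (intro sum.mono_neutral_cong_left) (auto split: if_splits)
  also have "\<dots> = (\<Sum>l\<in>anisotropic_lists k. \<Sum>c\<in>set cs. if P (c # l) then F (c # l) else 0)"
    by (rule sum.cartesian_product[symmetric])
  finally show ?thesis
    using distinct_cs by (simp add: sum_list_distinct_conv_sum_set)
qed

text \<open>Splitting the length as \<open>j + k\<close> lets the induction move one coordinate at a
  time from the search into the outer sum; the search from the empty list is
  \<open>j = 0\<close>.\<close>

lemma sum_anisotropic_lists_add:
  "(\<Sum>l\<in>anisotropic_lists (j + k). prod_list (map w l)) =
    (\<Sum>l\<in>anisotropic_lists j. prod_list (map w l) * pruned_sum P w cs k l)"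
proof (induction k arbitrary: j)
  case (Suc k)
  have "(\<Sum>l\<in>anisotropic_lists (j + Suc k). prod_list (map w l)) =
      (\<Sum>l\<in>anisotropic_lists (Suc j). prod_list (map w l) * pruned_sum P w cs k l)"
    using Suc.IH[of "Suc j"] by simp
  also have "\<dots> = (\<Sum>l\<in>anisotropic_lists j. prod_list (map w l) * pruned_sum P w cs (Suc k) l)"
    unfolding sum_anisotropic_lists_Suc
    by (intro sum.cong refl) (simp add: sum_list_const_mult[symmetric] if_distrib ac_simps cong: if_cong)
  finally show ?case .
qed simp

lemma sum_anisotropic_lists:
  "(\<Sum>l\<in>anisotropic_lists k. prod_list (map w l)) = pruned_sum P w cs k []"
  using sum_anisotropic_lists_add[of w 0 k] by (simp add: anisotropic_lists_0)

text \<open>With weight 1 the sum counts the anisotropic lists. If none has length \<open>m\<close>,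
  none is longer either, because its suffix of length \<open>m\<close> would be anisotropic.\<close>

lemma rho_eq_1:
  assumes "pruned_sum P (\<lambda>_. 1 :: int) cs m [] = 0" "m \<le> Suc n"
  shows "rho p n 2 = 1"
proof -
  have "int (card (anisotropic_lists m)) = (\<Sum>l\<in>anisotropic_lists m. prod_list (map (\<lambda>_. 1) l))"
    by (simp add: map_replicate_const)
  also have "\<dots> = 0" unfolding sum_anisotropic_lists by (rule assms(1))
  finally have "anisotropic_lists m = {}" using finite_anisotropic_lists by simp
  have "anisotropic_lists (Suc n) = {}"
    using assms(2) by (induction rule: dec_induct) (simp_all add: \<open>anisotropic_lists m = {}\<close> anisotropic_lists_Suc)
  then show ?thesis by (simp add: rho_eq_sum_anisotropic_lists)
qed

end

text \<open>Dividing a solution by \<open>p\<close> in the coordinates of even exponent exchanges the roles of the two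
  parities, so that a primitive solution may be assumed to have a unit in a coordinate of exponent
  parity \<open>e\<close>, whose coefficient has been normalised to a unit. The accumulators \<open>S\<close> and \<open>f\<close> make the
  condition recursive in the list.\<close>

definition solvable_mod :: "nat \<Rightarrow> nat \<Rightarrow> (nat \<times> int) list \<Rightarrow> int \<Rightarrow> bool \<Rightarrow> bool" where
  "solvable_mod p e l S f \<longleftrightarrow> (\<exists>x. (f \<or> (\<exists>i<length l. fst (l ! i) = e \<and> \<not> int p dvd x i)) \<and>
     int p ^ hensel_exp p dvd
       S + (\<Sum>j<length l. (if fst (l ! j) = e then 1 else int p) * snd (l ! j) * (x j)\<^sup>2))"

section \<open>Reduction to congruences with one fixed modulus\<close>

lemma solvable_mod_Nil: "solvable_mod p e [] S f \<longleftrightarrow> f \<and> int p ^ hensel_exp p dvd S"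
  by (simp add: solvable_mod_def)

lemma solvable_mod_cong:
  assumes "int p ^ hensel_exp p dvd S - S'"
  shows "solvable_mod p e l S f \<longleftrightarrow> solvable_mod p e l S' f"
proof -
  have "int p ^ hensel_exp p dvd S + t \<longleftrightarrow> int p ^ hensel_exp p dvd S' + t" for t
    using dvd_diff_imp_dvd_iff[of _ "S + t" "S' + t"] assms by simp
  then show ?thesis unfolding solvable_mod_def by simp
qed

lemma solvable_mod_Cons:
  "solvable_mod p e (c # l) S f \<longleftrightarrow>
    (\<exists>y. solvable_mod p e l (S + (if fst c = e then 1 else int p) * snd c * y\<^sup>2)
      (f \<or> (fst c = e \<and> \<not> int p dvd y)))"
    (is "?A \<longleftrightarrow> ?B")
proof
  assume ?A
  then obtain x where x: "(f \<or> (\<exists>i<length (c # l). fst ((c # l) ! i) = e \<and> \<not> int p dvd x i)) \<and>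
     int p ^ hensel_exp p dvd S + (\<Sum>j<length (c # l).
       (if fst ((c # l) ! j) = e then 1 else int p) * snd ((c # l) ! j) * (x j)\<^sup>2)"
    unfolding solvable_mod_def by (rule exE)
  have "solvable_mod p e l (S + (if fst c = e then 1 else int p) * snd c * (x 0)\<^sup>2)
      (f \<or> (fst c = e \<and> \<not> int p dvd x 0))"
    unfolding solvable_mod_def
    by (rule exI[where x = "\<lambda>i. x (Suc i)"])
      (use x in \<open>simp add: sum.lessThan_Suc_shift Ex_less_Suc2 add.assoc disj_assoc del: sum.lessThan_Suc\<close>)
  then show ?B by (rule exI[where x = "x 0"])
next
  assume ?B
  then obtain y where "solvable_mod p e l (S + (if fst c = e then 1 else int p) * snd c * y\<^sup>2)
      (f \<or> (fst c = e \<and> \<not> int p dvd y))"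
    by (rule exE)
  then obtain x where x: "((f \<or> (fst c = e \<and> \<not> int p dvd y)) \<or>
       (\<exists>i<length l. fst (l ! i) = e \<and> \<not> int p dvd x i)) \<and>
     int p ^ hensel_exp p dvd S + (if fst c = e then 1 else int p) * snd c * y\<^sup>2
       + (\<Sum>j<length l. (if fst (l ! j) = e then 1 else int p) * snd (l ! j) * (x j)\<^sup>2)"
    unfolding solvable_mod_def by (rule exE)
  show ?A
    unfolding solvable_mod_def
    by (rule exI[where x = "case_nat y x"])
      (use x in \<open>simp add: sum.lessThan_Suc_shift Ex_less_Suc2 add.assoc disj_assoc del: sum.lessThan_Suc\<close>)
qed

lemma diag_quad_iso_iff_solvable_mod:
  assumes "0 < p" "\<forall>c\<in>set l. fst c < 2"
  shows "diag_quad_iso p l \<longleftrightarrow> solvable_mod p 0 l 0 False \<or> solvable_mod p 1 l 0 False"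
proof -
  have fst_l: "fst (l ! j) = 0 \<or> fst (l ! j) = 1" if "j < length l" for j
    using assms(2) nth_mem[OF that] by fastforce
  define q where "q x = (\<Sum>j<length l. int p ^ fst (l ! j) * snd (l ! j) * (x j)\<^sup>2)" for x :: "nat \<Rightarrow> int"
  define q' where "q' e x = (\<Sum>j<length l. (if fst (l ! j) = e then 1 else int p) * snd (l ! j) * (x j)\<^sup>2)"
    for e :: nat and x :: "nat \<Rightarrow> int"
  have iso: "diag_quad_iso p l \<longleftrightarrow>
      (\<exists>x. \<exists>i<length l. \<not> int p dvd x i \<and> int p ^ (hensel_exp p + fst (l ! i)) dvd q x)"
    unfolding diag_quad_iso_def q_def ..
  have sol: "solvable_mod p e l 0 False \<longleftrightarrow>
      (\<exists>x. (\<exists>i<length l. fst (l ! i) = e \<and> \<not> int p dvd x i) \<and> int p ^ hensel_exp p dvd q' e x)" for e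
    unfolding solvable_mod_def q'_def by simp
  have q0: "q x = q' 0 x" for x
    unfolding q_def q'_def
  proof (intro sum.cong refl)
    fix j assume "j \<in> {..<length l}"
    then show "int p ^ fst (l ! j) * snd (l ! j) * (x j)\<^sup>2 = (if fst (l ! j) = 0 then 1 else int p) * snd (l ! j) * (x j)\<^sup>2"
      using fst_l[of j] by auto
  qed
  \<comment> \<open>The substitution gives p^2 at exponent 0 against p at exponent 1, so one factor
    p is common to all terms.\<close>
  have q1: "q (\<lambda>j. if fst (l ! j) = 0 then int p * z j else z j) = int p * q' 1 z" for z
    unfolding q_def q'_def sum_distrib_left
  proof (intro sum.cong refl)
    fix j assume "j \<in> {..<length l}"
    then show "int p ^ fst (l ! j) * snd (l ! j) * (if fst (l ! j) = 0 then int p * z j else z j)\<^sup>2 =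
        int p * ((if fst (l ! j) = 1 then 1 else int p) * snd (l ! j) * (z j)\<^sup>2)"
      using fst_l[of j] by (auto simp: power2_eq_square)
  qed
  have cancel: "int p ^ (hensel_exp p + 1) dvd int p * t \<longleftrightarrow> int p ^ hensel_exp p dvd t" for t
    using assms(1) by simp
  show ?thesis
  proof
    assume "diag_quad_iso p l"
    then obtain x where "\<exists>i<length l. \<not> int p dvd x i \<and> int p ^ (hensel_exp p + fst (l ! i)) dvd q x"
      unfolding iso by (rule exE)
    then obtain i where i: "i < length l" "\<not> int p dvd x i" "int p ^ (hensel_exp p + fst (l ! i)) dvd q x"
      by blast
    show "solvable_mod p 0 l 0 False \<or> solvable_mod p 1 l 0 False"
    proof (cases "\<exists>j<length l. fst (l ! j) = 0 \<and> \<not> int p dvd x j")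
      case True
      have "int p ^ hensel_exp p dvd q x" using i(3) by (metis dvd_mult_left power_add)
      with True have "solvable_mod p 0 l 0 False"
        unfolding sol q0 by (intro exI[where x = x] conjI)
      then show ?thesis ..
    next
      case False
      \<comment> \<open>Every coordinate of exponent 0 is now a multiple of p. Dividing these by p
        exposes the common factor, and the modulus drops from p^(L+1) to p^L with L =
        \<open>hensel_exp p\<close>.\<close>
      define z where "z j = (if fst (l ! j) = 0 then x j div int p else x j)" for j
      have fi: "fst (l ! i) = 1" using False i fst_l by blast
      have "x j = (if fst (l ! j) = 0 then int p * z j else z j)" if "j < length l" for j
        using False that by (auto simp: z_def)
      then have "q x = q (\<lambda>j. if fst (l ! j) = 0 then int p * z j else z j)"
        unfolding q_def by (intro sum.cong refl arg_cong2[where f = "(*)"] arg_cong[where f = "\<lambda>x. x\<^sup>2"]) simp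
      then have "int p ^ hensel_exp p dvd q' 1 z"
        using i(3) assms(1) unfolding q1 fi by simp
      moreover have "\<exists>i<length l. fst (l ! i) = 1 \<and> \<not> int p dvd z i"
        using fi i(1,2) by (intro exI[of _ i]) (simp add: z_def)
      ultimately have "solvable_mod p 1 l 0 False"
        unfolding sol by (intro exI[where x = z] conjI)
      then show ?thesis ..
    qed
  next
    assume "solvable_mod p 0 l 0 False \<or> solvable_mod p 1 l 0 False"
    then show "diag_quad_iso p l"
    proof
      assume "solvable_mod p 0 l 0 False"
      then obtain x where x: "(\<exists>i<length l. fst (l ! i) = 0 \<and> \<not> int p dvd x i) \<and> int p ^ hensel_exp p dvd q' 0 x"
        unfolding sol by (rule exE)
      then obtain i where i: "i < length l" "fst (l ! i) = 0" "\<not> int p dvd x i" by blast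
      show ?thesis
        unfolding iso q0
        by (rule exI[where x = x], rule exI[where x = i]) (use x i in simp)
    next
      assume "solvable_mod p 1 l 0 False"
      then obtain z where z: "(\<exists>i<length l. fst (l ! i) = 1 \<and> \<not> int p dvd z i) \<and> int p ^ hensel_exp p dvd q' 1 z"
        unfolding sol by (rule exE)
      then obtain i where i: "i < length l" "fst (l ! i) = 1" "\<not> int p dvd z i" by blast
      have "int p ^ (hensel_exp p + fst (l ! i)) dvd int p * q' 1 z"
        unfolding i(2) cancel using z by blast
      then show ?thesis
        unfolding iso
        by (intro exI[where x = "\<lambda>j. if fst (l ! j) = 0 then int p * z j else z j"] exI[where x = i])
          (use i in \<open>simp add: q1\<close>)
    qed
  qed
qed

section \<open>Odd primes\<close>

text \<open>Equal values force p to divide x - y or x + y, and on half the residues both are too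
  small in absolute value unless they vanish. The shift \<open>a\<close> prepares for the pigeonhole
  argument on ternary forms.\<close>

lemma inj_on_quadratic_mod:
  fixes t a :: int
  assumes "prime p" "\<not> int p dvd t"
  shows "inj_on (\<lambda>x. (t * x\<^sup>2 + a) mod int p) {0..(int p - 1) div 2}"
proof (rule inj_onI)
  fix x y :: int
  assume xy: "x \<in> {0..(int p - 1) div 2}" "y \<in> {0..(int p - 1) div 2}"
    and "(t * x\<^sup>2 + a) mod int p = (t * y\<^sup>2 + a) mod int p"
  then have "int p dvd (t * x\<^sup>2 + a) - (t * y\<^sup>2 + a)" by (simp only: mod_eq_dvd_iff)
  also have "(t * x\<^sup>2 + a) - (t * y\<^sup>2 + a) = t * ((x - y) * (x + y))"
    by (simp add: power2_eq_square algebra_simps)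
  finally have "int p dvd x - y \<or> int p dvd x + y"
    using assms by (simp add: prime_dvd_mult_iff)
  moreover have "x + y < int p" "0 \<le> x + y" "x - y < int p" "y - x < int p"
    using xy prime_gt_0_nat[OF assms(1)] by auto
  ultimately consider "x - y = 0" | "x + y = 0"
    by (smt (verit) dvd_imp_le_int dvd_diff_commute zdvd_not_zless)
  then show "x = y" using xy by cases auto
qed

text \<open>Of x and -x modulo p exactly one lies in the lower half, so the lower half already
  produces every value.\<close>

lemma square_class_residues_odd:
  assumes "prime p" "p \<noteq> 2" "\<not> int p dvd t"
  shows "square_class_residues p t = (\<lambda>x. (t * x\<^sup>2 + 0) mod int p) ` {1..(int p - 1) div 2}"
proof (intro equalityI subsetI)
  have p: "0 < int p" using prime_gt_0_nat[OF assms(1)] by simp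
  have pi: "prime (int p)" using assms(1) by simp
  {
    fix u assume "u \<in> square_class_residues p t"
    then obtain x where u: "0 \<le> u" "u < int p" "\<not> int p dvd u" and x: "int p dvd t * x\<^sup>2 - u"
      using assms(2) by (auto simp: square_class_residues_def hensel_exp_def)
    have "\<not> int p dvd t * x\<^sup>2" using u(3) dvd_diff_imp_dvd_iff[OF x] by simp
    then have nx: "\<not> int p dvd x" by (auto simp: power2_eq_square)
    define y where "y = x mod int p"
    have "y \<noteq> 0" using nx by (simp add: y_def mod_eq_0_iff_dvd)
    then have y: "0 < y" "y < int p"
      using pos_mod_sign[OF p, of x] pos_mod_bound[OF p, of x] unfolding y_def[symmetric] by linarith+
    have ux: "u = (t * y\<^sup>2) mod int p"
    proof -
      have "u = (t * x\<^sup>2) mod int p" using x u(1,2) by (metis mod_eq_dvd_iff mod_pos_pos_trivial)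
      also have "\<dots> = (t * y\<^sup>2) mod int p" by (metis y_def mod_mult_right_eq power_mod)
      finally show ?thesis .
    qed
    have "(t * (int p - y)\<^sup>2) mod int p = (t * y\<^sup>2) mod int p"
    proof -
      have "t * (int p - y)\<^sup>2 = t * y\<^sup>2 + int p * (t * (int p - 2 * y))"
        by (simp add: power2_eq_square algebra_simps)
      then show ?thesis by simp
    qed
    moreover have "y \<in> {1..(int p - 1) div 2} \<or> int p - y \<in> {1..(int p - 1) div 2}"
    proof -
      have "odd p" using assms(1,2) by (metis primes_dvd_imp_eq two_is_prime_nat)
      then have "odd (int p)" by simp
      then obtain k where "int p = 2 * k + 1" by (rule oddE)
      then show ?thesis using y by auto
    qed
    ultimately show "u \<in> (\<lambda>x. (t * x\<^sup>2 + 0) mod int p) ` {1..(int p - 1) div 2}"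
      using ux by (metis (no_types, lifting) add.right_neutral image_eqI)
  next
    fix u assume "u \<in> (\<lambda>x. (t * x\<^sup>2 + 0) mod int p) ` {1..(int p - 1) div 2}"
    then obtain x where x: "1 \<le> x" "x \<le> (int p - 1) div 2" and u: "u = (t * x\<^sup>2) mod int p" by auto
    have "\<not> int p dvd x" using x p by (auto dest!: zdvd_imp_le)
    then have "\<not> int p dvd t * x\<^sup>2" using assms(3) pi by (simp add: prime_dvd_mult_iff prime_dvd_power_iff)
    then have "\<not> int p dvd u" by (simp add: u dvd_mod_iff)
    moreover have "int p dvd t * x\<^sup>2 - u" by (simp add: u mod_eq_dvd_iff[symmetric])
    moreover have "0 \<le> u" "u < int p" using p by (simp_all add: u)
    ultimately show "u \<in> square_class_residues p t"
      using assms(2) by (auto simp: square_class_residues_def hensel_exp_def)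
  }
qed

lemma card_square_class_residues_odd:
  assumes "prime p" "p \<noteq> 2" "\<not> int p dvd t"
  shows "card (square_class_residues p t) = (p - 1) div 2"
proof -
  have "inj_on (\<lambda>x. (t * x\<^sup>2 + 0) mod int p) {1..(int p - 1) div 2}"
    by (rule inj_on_subset[OF inj_on_quadratic_mod[OF assms(1,3)]]) auto
  then have "card (square_class_residues p t) = card {1..(int p - 1) div 2}"
    unfolding square_class_residues_odd[OF assms] by (rule card_image)
  also have "\<dots> = (p - 1) div 2"
    using prime_gt_0_nat[OF assms(1)] by (simp add: nat_div_distrib nat_diff_distrib)
  finally show ?thesis .
qed

lemma finite_square_class_residues: "finite (square_class_residues p t)"
  by (rule finite_subset[of _ "{0..<int p ^ hensel_exp p}"]) (auto simp: square_class_residues_def)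

lemma square_class_residues_subset_odd:
  assumes "p \<noteq> 2"
  shows "square_class_residues p t \<subseteq> {1..<int p}"
proof
  fix u assume "u \<in> square_class_residues p t"
  then have "0 \<le> u" "u < int p" "\<not> int p dvd u"
    using assms by (auto simp: square_class_residues_def hensel_exp_def)
  then show "u \<in> {1..<int p}" by (cases "u = 0") auto
qed

text \<open>The (p - 1)/2 nonzero squares cannot exhaust the p - 1 units.\<close>

lemma quadratic_nonresidue_exists:
  assumes "prime p" "p \<noteq> 2"
  obtains g where "\<not> int p dvd g" "\<And>x. \<not> int p dvd x\<^sup>2 - g"
proof -
  have p2: "2 < p" using assms prime_ge_2_nat[of p] by simp
  have "\<not> int p dvd 1" using assms(1) by auto
  then have "card (square_class_residues p 1) = (p - 1) div 2"
    by (rule card_square_class_residues_odd[OF assms])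
  then have "card (square_class_residues p 1) < card {1..<int p}" using p2 by simp
  then have "square_class_residues p 1 \<noteq> {1..<int p}" by auto
  then obtain g where g: "g \<in> {1..<int p}" "g \<notin> square_class_residues p 1"
    using square_class_residues_subset_odd[OF assms(2), of 1] by blast
  have "\<not> int p dvd g" using g(1) by (auto dest: zdvd_imp_le)
  moreover from this have "\<not> int p dvd x\<^sup>2 - g" for x
    using g assms(2) by (auto simp: square_class_residues_def hensel_exp_def)
  ultimately show thesis by (rule that)
qed

text \<open>Pigeonhole: the values of \<open>t1 * x\<^sup>2\<close> and of
  \<open>- t2 - t3 * z\<^sup>2\<close> each fill (p + 1)/2 residues, so two of them coincide. Fixing
  the middle variable at 1 makes the solution nontrivial.\<close>

lemma ternary_mod_solvable:
  fixes t1 t2 t3 :: int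
  assumes "prime p" "p \<noteq> 2" "\<not> int p dvd t1" "\<not> int p dvd t3"
  obtains x z where "int p dvd t1 * x\<^sup>2 + t2 + t3 * z\<^sup>2"
proof -
  let ?I = "{0..(int p - 1) div 2}"
  let ?f = "\<lambda>x. (t1 * x\<^sup>2 + 0) mod int p" and ?g = "\<lambda>z. (- t3 * z\<^sup>2 + - t2) mod int p"
  have p: "0 < int p" using prime_gt_0_nat[OF assms(1)] by simp
  have "odd (int p)" using assms(1,2) primes_dvd_imp_eq two_is_prime_nat by (metis even_of_nat)
  then have cI: "2 * card ?I = p + 1" using p by (auto elim!: oddE)
  have "\<not> int p dvd - t3" using assms(4) by simp
  note inj = inj_on_quadratic_mod[OF assms(1,3), of 0] inj_on_quadratic_mod[OF assms(1) this, of "- t2"]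
  have c: "card (?f ` ?I) = card ?I" "card (?g ` ?I) = card ?I"
    using inj[THEN card_image] .
  have "?f ` ?I \<inter> ?g ` ?I \<noteq> {}"
  proof
    assume "?f ` ?I \<inter> ?g ` ?I = {}"
    then have "card (?f ` ?I \<union> ?g ` ?I) = p + 1"
      using c cI by (subst card_Un_disjoint) auto
    moreover have "card (?f ` ?I \<union> ?g ` ?I) \<le> card {0..<int p}"
      using p by (intro card_mono) auto
    ultimately show False by simp
  qed
  then obtain x z where "(t1 * x\<^sup>2 + 0) mod int p = (- t3 * z\<^sup>2 + - t2) mod int p" by auto
  then have "int p dvd (t1 * x\<^sup>2 + 0) - (- t3 * z\<^sup>2 + - t2)" by (simp only: mod_eq_dvd_iff)
  then have "int p dvd t1 * x\<^sup>2 + t2 + t3 * z\<^sup>2" by (simp add: algebra_simps)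
  then show thesis by (rule that)
qed

section \<open>Residue forms over the field with p elements\<close>

primrec residue_solvable :: "nat \<Rightarrow> int list \<Rightarrow> int \<Rightarrow> bool \<Rightarrow> bool" where
  "residue_solvable p [] S f \<longleftrightarrow> f \<and> int p dvd S"
| "residue_solvable p (t # ts) S f \<longleftrightarrow> (\<exists>y. residue_solvable p ts (S + t * y\<^sup>2) (f \<or> \<not> int p dvd y))"

text \<open>For odd p the modulus is p itself, so the terms carrying a factor p vanish and only the
  residue form of parity \<open>e\<close> is left, as in Springer's theorem.\<close>

lemma solvable_mod_odd_iff:
  assumes "p \<noteq> 2"
  shows "solvable_mod p e l S f \<longleftrightarrow> residue_solvable p (map snd (filter (\<lambda>c. fst c = e) l)) S f"
proof (induction l arbitrary: S f)
  case Nil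
  show ?case using assms by (simp add: solvable_mod_Nil hensel_exp_def)
next
  case (Cons c l)
  show ?case
  proof (cases "fst c = e")
    case False
    have "solvable_mod p e l (S + int p * snd c * y\<^sup>2) f \<longleftrightarrow> solvable_mod p e l S f" for y
      by (rule solvable_mod_cong) (use assms in \<open>simp add: hensel_exp_def\<close>)
    with False show ?thesis by (simp add: solvable_mod_Cons Cons)
  qed (simp add: solvable_mod_Cons Cons)
qed

lemma residue_solvable_True: "int p dvd S \<Longrightarrow> residue_solvable p ts S True"
  by (induction ts) (auto intro: exI[of _ 0])

lemma residue_solvable_ternary:
  assumes "prime p" "p \<noteq> 2" "\<not> int p dvd t1" "\<not> int p dvd t3"
  shows "residue_solvable p (t1 # t2 # t3 # ts) 0 False"
proof -
  obtain x z where "int p dvd t1 * x\<^sup>2 + t2 + t3 * z\<^sup>2"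
    using ternary_mod_solvable[OF assms] .
  then have "residue_solvable p ts (t1 * x\<^sup>2 + t2 + t3 * z\<^sup>2) True"
    by (rule residue_solvable_True)
  moreover have "\<not> int p dvd 1" using assms(1) by auto
  ultimately have "residue_solvable p ts (0 + t1 * x\<^sup>2 + t2 * 1\<^sup>2 + t3 * z\<^sup>2)
      (((False \<or> \<not> int p dvd x) \<or> \<not> int p dvd 1) \<or> \<not> int p dvd z)" by simp
  then show ?thesis unfolding residue_solvable.simps by blast
qed

text \<open>Here \<open>True\<close> stands for the residues and \<open>False\<close> for the non-residues, and \<open>s\<close> tells whether \<open>-1\<close> is
  a residue.\<close>

fun residue_anisotropic :: "bool \<Rightarrow> bool list \<Rightarrow> bool" where
  "residue_anisotropic s (b # b' # bs) = (if bs = [] then (b = b') \<noteq> s else False)"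
| "residue_anisotropic s bs = True"

definition odd_anisotropic :: "bool \<Rightarrow> (nat \<times> bool) list \<Rightarrow> bool" where
  "odd_anisotropic s l = (if residue_anisotropic s (map snd (filter (\<lambda>c. fst c = 0) l))
     then residue_anisotropic s (map snd (filter (\<lambda>c. fst c = 1) l)) else False)"

definition odd_classes :: "(nat \<times> bool) list" where
  "odd_classes = [(0, False), (0, True), (1, False), (1, True)]"

text \<open>The variables split as 2 + 1 over the parities: 3 positions for the single one, 2 of the
  4 pairs anisotropic and 2 choices for the single class give 12 for either split.\<close>

lemma pruned_sum_odd_3:
  fixes \<alpha> \<beta> :: real
  assumes "\<And>b. w (0, b) = \<alpha>" "\<And>b. w (Suc 0, b) = \<beta>"
  shows "pruned_sum (odd_anisotropic s) w odd_classes (Suc (Suc (Suc 0))) [] = 12 * \<alpha> * \<beta> * (\<alpha> + \<beta>)"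
  by (cases s) (simp_all add: odd_anisotropic_def odd_classes_def assms algebra_simps)

text \<open>The only possible split is 2 + 2: 6 choices of positions and 2 anisotropic pairs for
  each parity give 24.\<close>

lemma pruned_sum_odd_4:
  fixes \<alpha> \<beta> :: real
  assumes "\<And>b. w (0, b) = \<alpha>" "\<And>b. w (Suc 0, b) = \<beta>"
  shows "pruned_sum (odd_anisotropic s) w odd_classes (Suc (Suc (Suc (Suc 0)))) [] = 24 * (\<alpha> * \<beta>)\<^sup>2"
  by (cases s) (simp_all add: odd_anisotropic_def odd_classes_def assms power2_eq_square)

text \<open>Among five variables one parity occurs at least three times.\<close>

lemma pruned_sum_odd_5:
  "pruned_sum (odd_anisotropic s) (\<lambda>_. 1 :: int) odd_classes (Suc (Suc (Suc (Suc (Suc 0))))) [] = 0"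
proof -
  have "pruned_sum (odd_anisotropic True) (\<lambda>_. 1 :: int) odd_classes (Suc (Suc (Suc (Suc (Suc 0))))) [] = 0"
    "pruned_sum (odd_anisotropic False) (\<lambda>_. 1 :: int) odd_classes (Suc (Suc (Suc (Suc (Suc 0))))) [] = 0"
    by code_simp+
  then show ?thesis by (cases s) (simp_all only:)
qed

section \<open>Quadratic residues and binary forms modulo an odd prime\<close>

locale odd_prime_nonresidue =
  fixes p :: nat and g :: int
  assumes prime_p: "prime p" and p_neq_2: "p \<noteq> 2"
    and unit_g: "\<not> int p dvd g" and nonresidue_g: "\<And>x. \<not> int p dvd x\<^sup>2 - g"
begin

abbreviation rep :: "bool \<Rightarrow> int" where "rep b \<equiv> if b then 1 else g"

definition minus1_square :: bool where "minus1_square \<longleftrightarrow> (\<exists>z. int p dvd z\<^sup>2 + 1)"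

lemma prime_int: "prime (int p)"
  using prime_p by simp

lemma dvd_square_iff: "int p dvd y\<^sup>2 \<longleftrightarrow> int p dvd y"
  using prime_dvd_power_iff[OF prime_int, of 2 y] by simp

lemma not_dvd_1: "\<not> int p dvd 1"
  using prime_p by auto

lemma not_dvd_rep: "\<not> int p dvd rep b"
  using unit_g not_dvd_1 by simp

lemma inverse_mod:
  assumes "\<not> int p dvd y"
  obtains w where "int p dvd y * w - 1"
proof -
  have "coprime y (int p)" using assms prime_int by (metis coprime_commute prime_imp_coprime)
  then obtain w where "[y * w = 1] (mod int p)" using cong_solve_coprime_int by blast
  then show thesis using that by (simp add: cong_iff_dvd_diff)
qed

lemma quotient_square:
  assumes "\<not> int p dvd y" "int p dvd a * y\<^sup>2 + b * x\<^sup>2"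
  obtains w where "int p dvd a + b * w\<^sup>2"
proof -
  obtain v where v: "int p dvd y * v - 1" using inverse_mod[OF assms(1)] .
  \<comment> \<open>\<open>v\<close> inverts y modulo p, and the correction term comes from a y^2
    v^2 - a = a (y v - 1)(y v + 1).\<close>
  have "a + b * (x * v)\<^sup>2 = (a * y\<^sup>2 + b * x\<^sup>2) * v\<^sup>2 - (y * v - 1) * (a * (y * v + 1))"
    by (simp add: power2_eq_square algebra_simps)
  then have "int p dvd a + b * (x * v)\<^sup>2" using assms(2) v by (metis dvd_diff dvd_mult2)
  then show thesis by (rule that)
qed

lemma square_class_residues_disjoint:
  assumes "u \<in> square_class_residues p (rep s)" "u \<in> square_class_residues p (rep t)"
  shows "s = t"
proof (rule ccontr)
  assume "s \<noteq> t"
  then obtain x y where "int p dvd 1 * x\<^sup>2 - u" "int p dvd g * y\<^sup>2 - u" and u: "\<not> int p dvd u"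
    using assms p_neq_2 by (cases s; cases t) (auto simp: square_class_residues_def hensel_exp_def)
  then have "int p dvd (g * y\<^sup>2 - u) - (1 * x\<^sup>2 - u)" by (metis dvd_diff)
  then have "int p dvd g * y\<^sup>2 + (- 1) * x\<^sup>2" by simp
  moreover have "\<not> int p dvd g * y\<^sup>2"
    using dvd_diff_imp_dvd_iff[OF \<open>int p dvd g * y\<^sup>2 - u\<close>] u by simp
  then have "\<not> int p dvd y" by (auto simp: power2_eq_square)
  ultimately obtain w where "int p dvd g + (- 1) * w\<^sup>2" using quotient_square by blast
  then show False using nonresidue_g[of w] dvd_minus_iff[of "int p" "w\<^sup>2 - g"] by simp
qed

text \<open>By counting: two disjoint sets of (p - 1)/2 units exhaust the p - 1 units.\<close>

lemma square_class_residues_cover: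
  assumes "0 \<le> u" "u < int p ^ hensel_exp p" "\<not> int p dvd u"
  shows "\<exists>t\<in>UNIV. u \<in> square_class_residues p (rep t)"
proof -
  let ?A = "square_class_residues p (rep True)" and ?B = "square_class_residues p (rep False)"
  have "card ?A = (p - 1) div 2" "card ?B = (p - 1) div 2"
    by (intro card_square_class_residues_odd prime_p p_neq_2 not_dvd_rep)+
  moreover have "?A \<inter> ?B = {}" using square_class_residues_disjoint by blast
  moreover have "even (p - 1)" using prime_p p_neq_2 by (metis even_diff_nat even_add odd_one primes_dvd_imp_eq two_is_prime_nat)
  ultimately have "card (?A \<union> ?B) = p - 1"
    using finite_square_class_residues by (subst card_Un_disjoint) (simp_all add: mult_2[symmetric])
  moreover have "?A \<union> ?B \<subseteq> {1..<int p}"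
    using square_class_residues_subset_odd[OF p_neq_2] by blast
  ultimately have "?A \<union> ?B = {1..<int p}"
    by (intro card_subset_eq) auto
  moreover have "u \<in> {1..<int p}"
    using assms p_neq_2 by (cases "u = 0") (auto simp: hensel_exp_def)
  ultimately show ?thesis by blast
qed

sublocale square_classes p UNIV rep "(p - 1) div 2"
proof
  show "s = t" if "s \<in> UNIV" "t \<in> UNIV" "u \<in> square_class_residues p (rep s)"
    "u \<in> square_class_residues p (rep t)" for s t u
    using that(3,4) by (rule square_class_residues_disjoint)
  show "\<exists>t\<in>UNIV. u \<in> square_class_residues p (rep t)"
    if "0 \<le> u" "u < int p ^ hensel_exp p" "\<not> int p dvd u" for u
    using that by (rule square_class_residues_cover)
qed (simp_all only: prime_p p_neq_2 not_dvd_rep card_square_class_residues_odd finite not_False_eq_True)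

text \<open>If -1 and -g were both squares, so would be g. If -1 is not a square, it is g times a
  square, and multiplying by g makes -g a square.\<close>

lemma minus_g_square_iff: "(\<exists>z. int p dvd z\<^sup>2 + g) \<longleftrightarrow> \<not> minus1_square"
proof
  assume "\<exists>z. int p dvd z\<^sup>2 + g"
  then obtain z where z: "int p dvd z\<^sup>2 + g" ..
  show "\<not> minus1_square"
  proof
    assume minus1_square
    then obtain y where y: "int p dvd y\<^sup>2 + 1" by (auto simp: minus1_square_def)
    have "(z * y)\<^sup>2 - g = z\<^sup>2 * (y\<^sup>2 + 1) - (z\<^sup>2 + g)" by (simp add: power2_eq_square algebra_simps)
    then have "int p dvd (z * y)\<^sup>2 - g" using y z by (metis dvd_diff dvd_mult)
    then show False using nonresidue_g by blast
  qed
next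
  assume n: "\<not> minus1_square"
  have "0 < int p" using prime_p prime_gt_0_nat by simp
  define u where "u = (- 1) mod int p"
  have "\<not> int p dvd u" using not_dvd_1 by (simp add: u_def dvd_mod_iff)
  then obtain t where t: "u \<in> square_class_residues p (rep t)"
    using square_class_residues_cover[of u] \<open>0 < int p\<close> p_neq_2 by (auto simp: u_def hensel_exp_def)
  then obtain x where "int p dvd rep t * x\<^sup>2 - u"
    using p_neq_2 by (auto simp: square_class_residues_def hensel_exp_def)
  moreover have "int p dvd u - (- 1)" by (simp only: u_def mod_eq_dvd_iff[symmetric] mod_mod_trivial)
  ultimately have "int p dvd (rep t * x\<^sup>2 - u) + (u - (- 1))" by (rule dvd_add)
  then have x: "int p dvd rep t * x\<^sup>2 + 1" by simp
  then have "\<not> t" using n by (auto simp: minus1_square_def)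
  then have "int p dvd g * (g * x\<^sup>2 + 1)" using x by simp
  also have "g * (g * x\<^sup>2 + 1) = (g * x)\<^sup>2 + g" by (simp add: power2_eq_square algebra_simps)
  finally show "\<exists>z. int p dvd z\<^sup>2 + g" ..
qed

lemma binary_residue_solvable:
  "residue_solvable p [a, b] 0 False \<longleftrightarrow> (\<exists>w. int p dvd a + b * w\<^sup>2)"
  if a: "\<not> int p dvd a" and b: "\<not> int p dvd b" for a b
proof
  assume "residue_solvable p [a, b] 0 False"
  then obtain y x where xy: "int p dvd a * y\<^sup>2 + b * x\<^sup>2" "\<not> int p dvd y \<or> \<not> int p dvd x" by auto
  have "\<not> int p dvd y"
  proof
    assume y: "int p dvd y"
    then have "int p dvd a * y\<^sup>2" by (simp add: power2_eq_square)
    then have "int p dvd b * x\<^sup>2" using xy(1) by (simp add: dvd_add_right_iff)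
    then have "int p dvd x" using b by (simp add: prime_dvd_mult_iff[OF prime_int] dvd_square_iff)
    with y xy(2) show False by blast
  qed
  with xy(1) show "\<exists>w. int p dvd a + b * w\<^sup>2" using quotient_square by blast
next
  assume "\<exists>w. int p dvd a + b * w\<^sup>2"
  then obtain w where "int p dvd a + b * w\<^sup>2" ..
  then have "int p dvd 0 + a * 1\<^sup>2 + b * w\<^sup>2 \<and> ((False \<or> \<not> int p dvd 1) \<or> \<not> int p dvd w)"
    using not_dvd_1 by simp
  then show "residue_solvable p [a, b] 0 False" unfolding residue_solvable.simps by blast
qed

text \<open>A binary form with unit coefficients a, b is isotropic exactly when -ab is a square
  modulo p. Up to squares, -ab is -1 for equal classes and -g for different ones; from three
  variables on, the pigeonhole solution applies.\<close>

lemma residue_anisotropic_iff: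
  "residue_anisotropic minus1_square bs \<longleftrightarrow> \<not> residue_solvable p (map rep bs) 0 False"
proof -
  consider "bs = []" | b where "bs = [b]" | b b' where "bs = [b, b']" | b b' b'' bs' where "bs = b # b' # b'' # bs'"
    by (metis neq_Nil_conv)
  then show ?thesis
  proof cases
    case 2
    then show ?thesis
      using not_dvd_rep[of b] by (auto simp: prime_dvd_mult_iff[OF prime_int] dvd_square_iff)
  next
    case 3
    have "residue_solvable p [rep b, rep b'] 0 False \<longleftrightarrow> (\<exists>w. int p dvd rep b + rep b' * w\<^sup>2)"
      by (intro binary_residue_solvable not_dvd_rep)
    also have "\<dots> \<longleftrightarrow> (b = b') = minus1_square"
    proof (cases "b = b'")
      case True
      have "int p dvd rep b + rep b * w\<^sup>2 \<longleftrightarrow> int p dvd w\<^sup>2 + 1" for w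
      proof -
        have "rep b + rep b * w\<^sup>2 = rep b * (w\<^sup>2 + 1)" by (simp add: algebra_simps)
        then show ?thesis using not_dvd_rep[of b] prime_int by (simp only: prime_dvd_mult_iff) blast
      qed
      then show ?thesis using True by (simp add: minus1_square_def)
    next
      case False
      have "(\<exists>w. int p dvd 1 + g * w\<^sup>2) \<longleftrightarrow> (\<exists>w. int p dvd g + 1 * w\<^sup>2)"
      proof
        assume "\<exists>w. int p dvd 1 + g * w\<^sup>2"
        then obtain w where w: "int p dvd g * w\<^sup>2 + 1 * 1\<^sup>2" by (auto simp: add.commute)
        then have "\<not> int p dvd w" using not_dvd_1 by (auto simp: power2_eq_square dvd_add_right_iff)
        from quotient_square[OF this w] show "\<exists>w. int p dvd g + 1 * w\<^sup>2" by blast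
      next
        assume "\<exists>w. int p dvd g + 1 * w\<^sup>2"
        then obtain w where w: "int p dvd 1 * w\<^sup>2 + g * 1\<^sup>2" by (auto simp: add.commute)
        then have "\<not> int p dvd w" using unit_g by (auto simp: power2_eq_square dvd_add_right_iff)
        from quotient_square[OF this w] show "\<exists>w. int p dvd 1 + g * w\<^sup>2" by blast
      qed
      then show ?thesis
        using False minus_g_square_iff by (cases b; cases b') (simp_all add: add.commute)
    qed
    finally show ?thesis using 3 by auto
  next
    case 4
    then show ?thesis using residue_solvable_ternary[OF prime_p p_neq_2 not_dvd_rep[of b] not_dvd_rep[of b''], of "rep b'"]
      by (auto simp del: residue_solvable.simps)
  qed simp
qed

sublocale enumerated_square_classes p UNIV rep "(p - 1) div 2" odd_classes "odd_anisotropic minus1_square"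
proof
  show "set odd_classes = sq_classes"
    by (auto simp: odd_classes_def sq_classes_def less_2_cases_iff)
  show "distinct odd_classes" by (simp add: odd_classes_def)
next
  fix l assume "set l \<subseteq> sq_classes"
  let ?l = "map (\<lambda>c. (fst c, rep (snd c))) l"
  have "\<forall>c\<in>set ?l. fst c < 2" using \<open>set l \<subseteq> sq_classes\<close> by (auto simp: sq_classes_def)
  then have iso: "diag_quad_iso p ?l \<longleftrightarrow> solvable_mod p 0 ?l 0 False \<or> solvable_mod p 1 ?l 0 False"
    by (rule diag_quad_iso_iff_solvable_mod[OF prime_gt_0_nat[OF prime_p]])
  have units: "map snd (filter (\<lambda>c. fst c = e) ?l) = map rep (map snd (filter (\<lambda>c. fst c = e) l))" for e
    by (simp add: filter_map o_def)
  show "odd_anisotropic minus1_square l \<longleftrightarrow> \<not> diag_quad_iso p ?l"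
    unfolding iso solvable_mod_odd_iff[OF p_neq_2] units odd_anisotropic_def residue_anisotropic_iff
    by (simp del: map_map)
qed

lemma class_weight_odd:
  "class_weight (0, b) = real p / (2 * (real p + 1))" "class_weight (Suc 0, b) = 1 / (2 * (real p + 1))"
proof -
  have "odd p" using prime_p p_neq_2 by (metis primes_dvd_imp_eq two_is_prime_nat)
  then have N: "real ((p - 1) div 2) = (real p - 1) / 2"
    by (auto elim!: oddE)
  have p1: "1 < real p" using prime_gt_1_nat[OF prime_p] by simp
  have "1 - 1 / (real p)\<^sup>2 = (real p - 1) * (real p + 1) / (real p)\<^sup>2"
    using p1 by (simp add: field_simps power2_eq_square)
  then show "class_weight (0, b) = real p / (2 * (real p + 1))" "class_weight (Suc 0, b) = 1 / (2 * (real p + 1))"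
    unfolding class_weight_def N
    using p1 p_neq_2 by (simp_all add: hensel_exp_def divide_simps power2_eq_square)
qed

lemma rho_odd_2: "rho p 2 2 = 1 - 3 / 2 * real p / (real p + 1)\<^sup>2"
proof -
  have "rho p (Suc (Suc 0)) 2 = 1 - 3 / 2 * real p / (real p + 1)\<^sup>2"
    unfolding rho_eq_sum_anisotropic_lists sum_anisotropic_lists pruned_sum_odd_3[OF class_weight_odd]
    by (simp add: divide_simps) (simp add: power2_eq_square algebra_simps)
  then show ?thesis by (simp only: numeral_2_eq_2)
qed

lemma rho_odd_3: "rho p 3 2 = 1 - 3 / 2 * (real p)\<^sup>2 / (real p + 1) ^ 4"
proof -
  have "rho p (Suc (Suc (Suc 0))) 2 = 1 - 3 / 2 * (real p)\<^sup>2 / (real p + 1) ^ 4"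
  proof -
    define x where "x = real p + 1"
    have "x \<noteq> 0" by (simp add: x_def)
    then have "24 * (real p / (2 * x) * (1 / (2 * x)))\<^sup>2 = 3 / 2 * (real p)\<^sup>2 / x ^ 4"
      by (simp add: power2_eq_square power4_eq_xxxx)
    then show ?thesis
      unfolding rho_eq_sum_anisotropic_lists sum_anisotropic_lists pruned_sum_odd_4[OF class_weight_odd] x_def
      by simp
  qed
  then show ?thesis by (simp only: numeral_3_eq_3)
qed

lemma rho_odd_ge_4: "4 \<le> n \<Longrightarrow> rho p n 2 = 1"
  using rho_eq_1[OF pruned_sum_odd_5] by simp

end

lemma one_minus_inverse_quotient:
  fixes x :: real
  assumes "1 < x"
  shows "(1 - 1 / x) / (1 - 1 / x ^ 2) = x / (x + 1)"
proof -
  have "1 - 1 / x ^ 2 = (1 - 1 / x) * ((x + 1) / x)"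
    using assms by (simp add: field_simps power2_eq_square)
  moreover have "1 - 1 / x \<noteq> 0" using assms by simp
  ultimately show ?thesis by simp
qed

section \<open>The prime two\<close>

text \<open>Modulo 8 a square is 1, 0 or 4; a coordinate with unit coefficient \<open>t\<close> thus contributes \<open>t\<close>, 0 or
  4, and one with coefficient \<open>2 * t\<close> contributes \<open>2 * t\<close> or 0. Nested conditionals instead of
  disjunctions let the simplifier stop at the first solution.\<close>

fun dyadic_search :: "(nat \<times> int) list \<Rightarrow> nat \<Rightarrow> int \<Rightarrow> bool \<Rightarrow> bool" where
  "dyadic_search [] e S f = (if f then S mod 8 = 0 else False)"
| "dyadic_search (c # l) e S f = (if fst c = e then
     (if dyadic_search l e (S + snd c) True then True else
      if dyadic_search l e S f then True else dyadic_search l e (S + 4) f)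
      else (if dyadic_search l e S f then True else dyadic_search l e (S + 2 * snd c) f))"

definition dyadic_anisotropic :: "(nat \<times> int) list \<Rightarrow> bool" where
  "dyadic_anisotropic l = (if dyadic_search l 0 0 False then False else \<not> dyadic_search l 1 0 False)"

text \<open>The eight square classes of the 2-adic numbers: two parities, and the odd residues
  modulo 8 for the units.\<close>

definition dyadic_classes :: "(nat \<times> int) list" where
  "dyadic_classes = List.product [0, 1] [1, 3, 5, 7]"

lemma odd_square_mod_8:
  fixes x :: int
  assumes "odd x"
  shows "8 dvd x\<^sup>2 - 1"
proof -
  obtain k where k: "x = 2 * k + 1" using assms by (rule oddE)
  have "even (k * (k + 1))" by simp
  then obtain m where m: "k * (k + 1) = 2 * m" by (rule evenE)
  have "x\<^sup>2 - 1 = 4 * (k * (k + 1))" by (simp add: k power2_eq_square algebra_simps)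
  also have "\<dots> = 8 * m" by (simp add: m)
  finally show ?thesis by simp
qed

lemma dyadic_search_iff:
  assumes "\<forall>c\<in>set l. odd (snd c)"
  shows "dyadic_search l e S f \<longleftrightarrow> solvable_mod 2 e l S f"
  using assms
proof (induction l arbitrary: S f)
  case Nil
  show ?case by (auto simp: solvable_mod_Nil hensel_exp_def)
next
  case (Cons c l)
  let ?V = "solvable_mod 2 e l"
  have IH: "dyadic_search l e S f = ?V S f" for S f using Cons by simp
  have solvable_mod_2_cong: "solvable_mod 2 e l S f = solvable_mod 2 e l S' f" if "8 dvd S - S'" for S S' f
    using that by (intro solvable_mod_cong) (simp add: hensel_exp_def)
  have odd: "odd (snd c)" using Cons.prems by simp
  \<comment> \<open>These three classes decide the square modulo 8 (1, 0 and 4), and only the odd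
    one provides a unit coordinate.\<close>
  have split: "(\<exists>y::int. Q y) \<longleftrightarrow> (\<exists>y. odd y \<and> Q y) \<or> (\<exists>y. Q (4 * y)) \<or> (\<exists>y. Q (4 * y + 2))" for Q
  proof
    assume "\<exists>y. Q y"
    then obtain y where y: "Q y" by blast
    have "odd y \<or> y mod 4 = 0 \<or> y mod 4 = 2" by presburger
    then show "(\<exists>y. odd y \<and> Q y) \<or> (\<exists>y. Q (4 * y)) \<or> (\<exists>y. Q (4 * y + 2))"
      using y mult_div_mod_eq[of 4 y] by (metis add.right_neutral)
  qed blast
  have o: "8 dvd (S + k * snd c * y\<^sup>2) - (S + k * snd c)" if "odd y" for y k
    using dvd_mult[OF odd_square_mod_8[OF that], of "k * snd c"] by (simp add: algebra_simps)
  have z: "8 dvd (S + k * snd c * (4 * y)\<^sup>2) - S" for y k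
  proof -
    have "(S + k * snd c * (4 * y)\<^sup>2) - S = 8 * (2 * k * snd c * y\<^sup>2)" by (simp add: power2_eq_square)
    then show ?thesis by (simp only: dvd_triv_left)
  qed
  \<comment> \<open>4 times an odd number is 4 modulo 8 whatever the coefficient, which is why the
    search adds a bare 4.\<close>
  have w: "8 dvd (S + 1 * snd c * (4 * y + 2)\<^sup>2) - (S + 4)" for y
  proof -
    obtain m where m: "snd c = 2 * m + 1" using odd by (rule oddE)
    have "(S + 1 * snd c * (4 * y + 2)\<^sup>2) - (S + 4) = 8 * (snd c * (2 * y\<^sup>2 + 2 * y) + m)"
      by (simp add: m power2_eq_square algebra_simps)
    then show ?thesis by (simp only: dvd_triv_left)
  qed
  have w2: "8 dvd (S + 2 * snd c * (4 * y + 2)\<^sup>2) - S" for y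
  proof -
    have "(S + 2 * snd c * (4 * y + 2)\<^sup>2) - S = 8 * (snd c * (4 * y\<^sup>2 + 4 * y + 1))"
      by (simp add: power2_eq_square algebra_simps)
    then show ?thesis by (simp only: dvd_triv_left)
  qed
  have odd_iff: "(\<exists>y. odd y \<and> ?V (S + k * snd c * y\<^sup>2) g) \<longleftrightarrow> ?V (S + k * snd c) g" for k g
    using solvable_mod_2_cong[OF o] by (auto intro: exI[of _ 1])
  show ?case
  proof (cases "fst c = e")
    case True
    have "solvable_mod 2 e (c # l) S f \<longleftrightarrow> (\<exists>y. ?V (S + 1 * snd c * y\<^sup>2) (f \<or> odd y))"
      unfolding solvable_mod_Cons using True by simp
    also have "\<dots> \<longleftrightarrow> ?V (S + 1 * snd c) True \<or> ?V S f \<or> ?V (S + 4) f"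
    proof -
      have "(\<exists>y. odd y \<and> ?V (S + 1 * snd c * y\<^sup>2) (f \<or> odd y)) \<longleftrightarrow> ?V (S + 1 * snd c) True"
        unfolding odd_iff[symmetric] by (intro ex_cong1) auto
      then show ?thesis
        unfolding split[of "\<lambda>y. ?V (S + 1 * snd c * y\<^sup>2) (f \<or> odd y)"]
          solvable_mod_2_cong[OF z] solvable_mod_2_cong[OF w] by simp
    qed
    finally show ?thesis using True by (simp add: IH)
  next
    case False
    have "solvable_mod 2 e (c # l) S f \<longleftrightarrow> (\<exists>y. ?V (S + 2 * snd c * y\<^sup>2) f)"
      unfolding solvable_mod_Cons using False by simp
    also have "\<dots> \<longleftrightarrow> ?V (S + 2 * snd c) f \<or> ?V S f"
      unfolding split[of "\<lambda>y. ?V (S + 2 * snd c * y\<^sup>2) f"]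
        odd_iff solvable_mod_2_cong[OF z] solvable_mod_2_cong[OF w2] by simp
    finally show ?thesis using False by (auto simp: IH)
  qed
qed

text \<open>Odd squares are 1 modulo 8, so multiplying \<open>t\<close> by one does not move it,
  while even squares give no odd residue.\<close>

lemma square_class_residues_2:
  assumes "t \<in> {1, 3, 5, 7}"
  shows "square_class_residues 2 t = {t}"
proof -
  have *: "8 dvd t * x\<^sup>2 - t" if "odd x" for x :: int
    using dvd_mult[OF odd_square_mod_8[OF that], of t] by (simp add: algebra_simps)
  have "u = t" if u: "0 \<le> u" "u < 8" "odd u" "8 dvd t * x\<^sup>2 - u" for u x
  proof -
    have "odd x"
    proof
      assume "even x"
      then have "even (t * x\<^sup>2)" by simp
      moreover have "even (t * x\<^sup>2 - u)" using u(4) by (rule dvd_trans[rotated]) simp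
      ultimately show False using u(3) by simp
    qed
    from dvd_diff[OF *[OF this] u(4)] have "8 dvd u - t" by simp
    then have "u mod 8 = t mod 8" by (simp add: mod_eq_dvd_iff)
    then show "u = t" using u(1,2) assms by auto
  qed
  then have "u \<in> {t}" if "u \<in> square_class_residues 2 t" for u
    using that by (auto simp: square_class_residues_def hensel_exp_def)
  moreover have "t \<in> square_class_residues 2 t"
    using assms by (auto simp: square_class_residues_def hensel_exp_def intro!: exI[of _ 1])
  ultimately show ?thesis by blast
qed

interpretation dyadic: square_classes 2 "{1, 3, 5, 7}" "\<lambda>t. t" "Suc 0"
proof
  fix u :: int
  assume u: "0 \<le> u" "u < int 2 ^ hensel_exp 2" "\<not> int 2 dvd u"
  then have "u = 1 \<or> u = 3 \<or> u = 5 \<or> u = 7" unfolding hensel_exp_def by simp presburger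
  then have "u \<in> {1, 3, 5, 7}" by simp
  then show "\<exists>t\<in>{1, 3, 5, 7}. u \<in> square_class_residues 2 t"
    by (intro bexI[of _ u]) (simp_all add: square_class_residues_2)
next
  fix s t u :: int
  assume "s \<in> {1, 3, 5, 7}" "t \<in> {1, 3, 5, 7}" "u \<in> square_class_residues 2 s" "u \<in> square_class_residues 2 t"
  then show "s = t" by (simp only: square_class_residues_2 singleton_iff)
next
  fix t :: int
  assume t: "t \<in> {1, 3, 5, 7}"
  then show "\<not> int 2 dvd t" by auto
  show "card (square_class_residues 2 t) = Suc 0" using t by (simp only: square_class_residues_2 card_1_singleton_iff) simp
qed (simp_all only: two_is_prime_nat finite_insert finite.emptyI)

interpretation dyadic: enumerated_square_classes 2 "{1, 3, 5, 7}" "\<lambda>t. t" "Suc 0" dyadic_classes dyadic_anisotropic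
proof
  show "set dyadic_classes = dyadic.sq_classes"
    unfolding dyadic_classes_def dyadic.sq_classes_def set_product
  proof (intro equalityI subsetI)
    fix c :: "nat \<times> int"
    assume "c \<in> set [0, 1] \<times> set [1, 3, 5, 7]"
    then show "c \<in> {c. fst c < 2 \<and> snd c \<in> {1, 3, 5, 7}}" by (cases c) auto
  next
    fix c :: "nat \<times> int"
    assume "c \<in> {c. fst c < 2 \<and> snd c \<in> {1, 3, 5, 7}}"
    then show "c \<in> set [0, 1] \<times> set [1, 3, 5, 7]"
      unfolding mem_Times_iff by (simp add: less_2_cases_iff)
  qed
  show "distinct dyadic_classes"
    unfolding dyadic_classes_def by (rule distinct_product) simp_all
next
  fix l assume "set l \<subseteq> dyadic.sq_classes"
  then have "\<forall>c\<in>set l. odd (snd c)" "\<forall>c\<in>set l. fst c < 2"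
    by (auto simp: dyadic.sq_classes_def)
  then show "dyadic_anisotropic l \<longleftrightarrow> \<not> diag_quad_iso 2 (map (\<lambda>c. (fst c, snd c)) l)"
    by (simp add: dyadic_anisotropic_def dyadic_search_iff diag_quad_iso_iff_solvable_mod)
qed

text \<open>The geometric series gives 2^-(e+3) / (3/4) = 2^(1-e) / 12, and 2^(1-e) equals 2 - e for
  both parities. Pulling out the denominator leaves a sum of integers to enumerate.\<close>

lemma dyadic_weight:
  "set l \<subseteq> dyadic.sq_classes \<Longrightarrow>
   prod_list (map dyadic.class_weight l) = of_int (prod_list (map (\<lambda>c. 2 - int (fst c)) l)) / 12 ^ length l"
proof (induction l)
  case (Cons c l)
  then have w: "dyadic.class_weight c = of_int (2 - int (fst c)) / 12"
    by (auto simp: dyadic.class_weight_def dyadic.sq_classes_def hensel_exp_def less_2_cases_iff)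
  show ?case
    unfolding list.map prod_list.Cons w using Cons by simp
qed simp

abbreviation dyadic_count :: "nat \<Rightarrow> int" where
  "dyadic_count k \<equiv> pruned_sum dyadic_anisotropic (\<lambda>c. 2 - int (fst c)) dyadic_classes k []"

lemma rho_2_eq: "rho 2 n 2 = 1 - of_int (dyadic_count (Suc n)) / 12 ^ Suc n"
proof -
  have "(\<Sum>l\<in>dyadic.anisotropic_lists (Suc n). prod_list (map dyadic.class_weight l)) =
      (\<Sum>l\<in>dyadic.anisotropic_lists (Suc n). of_int (prod_list (map (\<lambda>c. 2 - int (fst c)) l)) / 12 ^ Suc n)"
    by (intro sum.cong refl) (auto simp: dyadic_weight dyadic.anisotropic_lists_def)
  also have "\<dots> = of_int (\<Sum>l\<in>dyadic.anisotropic_lists (Suc n). prod_list (map (\<lambda>c. 2 - int (fst c)) l)) / 12 ^ Suc n"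
    by (simp only: of_int_sum sum_divide_distrib)
  finally show ?thesis
    unfolding dyadic.rho_eq_sum_anisotropic_lists dyadic.sum_anisotropic_lists[symmetric] by simp
qed

text \<open>Divided by 12^3 and 12^4 these are the insoluble proportions 5/12 and 65/1296.\<close>

lemma dyadic_counts:
  "dyadic_count (Suc (Suc (Suc 0))) = 720" "dyadic_count (Suc (Suc (Suc (Suc 0)))) = 1040"
  by code_simp+

text \<open>Five variables always suffice over the 2-adic numbers; five coefficients correspond to n
  = 4.\<close>

lemma dyadic_lists_5:
  "pruned_sum dyadic_anisotropic (\<lambda>_. 1 :: int) dyadic_classes (Suc (Suc (Suc (Suc (Suc 0))))) [] = 0"
  by code_simp

lemma rho_2_values: "rho 2 2 2 = 7 / 12" "rho 2 3 2 = 1231 / 1296" "4 \<le> n \<Longrightarrow> rho 2 n 2 = 1"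
proof -
  have "rho 2 (Suc (Suc 0)) 2 = 7 / 12" "rho 2 (Suc (Suc (Suc 0))) 2 = 1231 / 1296"
    unfolding rho_2_eq dyadic_counts by simp_all
  then show "rho 2 2 2 = 7 / 12" "rho 2 3 2 = 1231 / 1296"
    by (simp_all only: numeral_2_eq_2 numeral_3_eq_3)
  show "4 \<le> n \<Longrightarrow> rho 2 n 2 = 1"
    using dyadic.rho_eq_1[OF dyadic_lists_5] by simp
qed

theorem theorem1p3:
  fixes p :: nat
  assumes "prime p"
  shows "rho p 2 2 = (if p = 2 then 7/12
           else 1 - 3/2 * (1 / real p) * ((1 - 1 / real p) / (1 - 1 / real p ^ 2)) ^ 2)
       \<and> rho p 3 2 = (if p = 2 then 1231/1296
           else 1 - 3/2 * (1 / real p ^ 2) * ((1 - 1 / real p) / (1 - 1 / real p ^ 2)) ^ 4)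
       \<and> (\<forall>n\<ge>4. rho p n 2 = 1)"
proof (cases "p = 2")
  case True
  then show ?thesis using rho_2_values by simp
next
  case False
  obtain g where "\<not> int p dvd g" "\<And>x. \<not> int p dvd x\<^sup>2 - g"
    using quadratic_nonresidue_exists[OF assms False] by blast
  then interpret odd_prime_nonresidue p g
    using assms False by unfold_locales
  have p: "1 < real p" using prime_gt_1_nat[OF assms] by simp
  have "3/2 * (1 / real p) * (real p / (real p + 1)) ^ 2 = 3/2 * real p / (real p + 1)\<^sup>2"
    "3/2 * (1 / real p ^ 2) * (real p / (real p + 1)) ^ 4 = 3/2 * (real p)\<^sup>2 / (real p + 1) ^ 4"
    using p by (simp_all add: power_divide power2_eq_square power4_eq_xxxx)
  then show ?thesis
    using False rho_odd_2 rho_odd_3 rho_odd_ge_4 unfolding one_minus_inverse_quotient[OF p] by simp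
qed

end
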